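(* The set $\{D_{\mathbf a,\mathbf b,\mathbf c}+\mathrm{Rad}(\mathbb{T}):(\mathbf a,\mathbf b,\mathbf c)\in\mathbb{P},\ p\nmid k_{\mathbf b}\}$ is an $\mathbb{F}$-basis of $\mathbb{T}/\mathrm{Rad}(\mathbb{T})$. In particular, the $\mathbb{F}$-dimension of $\mathbb{T}/\mathrm{Rad}(\mathbb{T})$ does not depend on the choice of $\mathbf x\in X$.
   Context: Let $\mathbb{F}$ be a field of characteristic $p\ge 0$; $\overline m$ is the image in $\mathbb{F}$ of an integer $m$, and for a positive integer $m$, "$p\mid m$" means $\overline m=0$. Let $n\ge 1$ and let $U_1,\dots,U_n$ be finite sets with $|U_h|\ge 2$. Put $X=U_1\times\cdots\times U_n$ and $E=\{0,1\}^n$. For $\mathbf g\in E$ let $S(\mathbf g)=\{a:\mathbf g_a=1\}$, and write $\mathbf g\preceq\mathbf h$ iff $S(\mathbf g)\subseteq S(\mathbf h)$; $\mathbf g\cap\mathbf h$ is the element with support $S(\mathbf g)\cap S(\mathbf h)$. For $V\subseteq\{1,\dots,n\}$ let $V^\circ=\{a\in V:|U_a|>2\}$. Let $R_{\mathbf g}=\{(\mathbf y,\mathbf z)\in X\times X:\ \mathbf y_a\neq\mathbf z_a\iff\mathbf g_a=1\}$ and $k_{\mathbf g}=\prod_{a\in S(\mathbf g)}(|U_a|-1)$ ($k_{\mathbf 0}=1$). Let $A_{\mathbf g}\in\mathrm{M}_X(\mathbb{F})$ be the $\{0,1\}$ adjacency matrix of $R_{\mathbf g}$. Fix $\mathbf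 x\in X$ and let $E^*_{\mathbf g}$ be the diagonal matrix with $(\mathbf y,\mathbf y)$-entry $1$ iff $(\mathbf x,\mathbf y)\in R_{\mathbf g}$, else $0$. $\mathbb{T}$ is the $\mathbb{F}$-subalgebra of $\mathrm{M}_X(\mathbb{F})$ generated by all $A_{\mathbf g},E^*_{\mathbf g}$, and $\mathrm{Rad}(\mathbb{T})$ is its Jacobson radical. Let $\mathbb{P}$ be the set of $(\mathbf a,\mathbf b,\mathbf c)\in E^3$ with $S(\mathbf a)\triangle S(\mathbf c)\subseteq S(\mathbf b)\subseteq(S(\mathbf a)\triangle S(\mathbf c))\cup(S(\mathbf a)\cap S(\mathbf c))^\circ$. For $(\mathbf g,\mathbf h,\mathbf i)\in\mathbb{P}$ let $B_{\mathbf g,\mathbf h,\mathbf i}=\sum_{\mathbf j}E^*_{\mathbf g}A_{\mathbf j}E^*_{\mathbf i}$ over all $\mathbf j\in E$ with $S(\mathbf g)\triangle S(\mathbf i)\subseteq S(\mathbf j)\subseteq S(\mathbf h)$. For $\mathbf g,\mathbf i\in E$ let $\mathbf g\mathbf i$ be the element of $E$ with support $(S(\mathbf g)\triangle S(\mathbf i))\cup(S(\mathbf g)\cap S(\mathbf i))^\circ$. For $\mathbf h\preceq\mathbf f$ in $E$ let $n_{\mathbf f,\mathbf h}=|\{a\in S(\mathbf f)\setminus S(\mathbf h): p\nmid |U_a|-1\}|$ and, for an integer $k\ge 0$, $\mathbb{U}_{\mathbf f,\mathbf h,k}=\{\mathbf a\in E:\ \mathbf h\preceq\mathbf a\preceq\mathbf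 f,\ p\nmid k_{\mathbf a},\ |S(\mathbf a)\setminus S(\mathbf h)|=k\}$. For $(\mathbf g,\mathbf h,\mathbf i)\in\mathbb{P}$ with $p\nmid k_{\mathbf h}$ define $D_{\mathbf g,\mathbf h,\mathbf i}=\sum_{k=0}^{n_{\mathbf g\mathbf i,\mathbf h}}\sum_{\mathbf l\in\mathbb{U}_{\mathbf g\mathbf i,\mathbf h,k}}(-1)^k\,\overline{k_{\mathbf i\cap\mathbf l}}^{\,-1}B_{\mathbf g,\mathbf l,\mathbf i}$. *)

theory Defs
  imports "Jordan_Normal_Form.VS_Connect" "HOL-Algebra.Subrings"
begin

section \<open>Algebras\<close>

text \<open>
  An algebra over the field \<^typ>\<open>'f::field\<close> is represented by a record of type
  \<^typ>\<open>('f, 'm) module\<close>, which extends a ring by a scalar multiplication; the field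
  itself is the record \<^term>\<open>class_ring\<close>.
  The full matrix algebra on an index set \<open>X\<close> consists of the functions of two arguments
  that vanish outside \<open>X \<times> X\<close>.
\<close>

definition mat_alg :: "'x set \<Rightarrow> ('f::field, 'x \<Rightarrow> 'x \<Rightarrow> 'f) module" where
  "mat_alg X =
    \<lparr>carrier = {A. \<forall>y z. (y, z) \<notin> X \<times> X \<longrightarrow> A y z = 0},
     mult = (\<lambda>A B y z. \<Sum>w\<in>X. A y w * B w z),
     one = (\<lambda>y z. if y \<in> X \<and> y = z then 1 else 0),
     zero = (\<lambda>y z. 0),
     add = (\<lambda>A B y z. A y z + B y z),
     smult = (\<lambda>c A y z. c * A y z)\<rparr>"

definition is_subalgebra :: "'m set \<Rightarrow> ('f, 'm) module \<Rightarrow> bool" where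
  "is_subalgebra H M \<longleftrightarrow> subring H M \<and> (\<forall>c. \<forall>a\<in>H. c \<odot>\<^bsub>M\<^esub> a \<in> H)"

definition generated_subalgebra :: "('f, 'm) module \<Rightarrow> 'm set \<Rightarrow> ('f, 'm) module" where
  "generated_subalgebra M G = M\<lparr>carrier := \<Inter>{H. is_subalgebra H M \<and> G \<subseteq> H}\<rparr>"

definition left_ideal :: "'m set \<Rightarrow> ('m, 'e) ring_scheme \<Rightarrow> bool" where
  "left_ideal J R \<longleftrightarrow>
    additive_subgroup J R \<and> (\<forall>r\<in>carrier R. \<forall>a\<in>J. r \<otimes>\<^bsub>R\<^esub> a \<in> J)"

definition maximal_left_ideal :: "'m set \<Rightarrow> ('m, 'e) ring_scheme \<Rightarrow> bool" where
  "maximal_left_ideal J R \<longleftrightarrow>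
    left_ideal J R \<and> J \<noteq> carrier R \<and>
    (\<forall>K. left_ideal K R \<and> J \<subseteq> K \<longrightarrow> K = J \<or> K = carrier R)"

definition jacobson_radical :: "('m, 'e) ring_scheme \<Rightarrow> 'm set" where
  "jacobson_radical R = carrier R \<inter> \<Inter>{J. maximal_left_ideal J R}"

definition quotient_algebra :: "('f, 'm) module \<Rightarrow> 'm set \<Rightarrow> ('f, 'm set) module" where
  "quotient_algebra M I =
    ring.extend (M Quot I) (module.fields (\<lambda>c C. \<Union>a\<in>C. I +>\<^bsub>M\<^esub> (c \<odot>\<^bsub>M\<^esub> a)))"

section \<open>Factorial schemes and their Terwilliger algebras\<close>

text \<open>The factors are indexed by \<open>{1..n}\<close>; only the values of \<open>U\<close> there matter.\<close>

definition points :: "nat \<Rightarrow> (nat \<Rightarrow> 'u set) \<Rightarrow> (nat \<Rightarrow> 'u) set" where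
  "points n U = (\<Pi>\<^sub>E a\<in>{1..n}. U a)"

definition bin_vecs :: "nat \<Rightarrow> (nat \<Rightarrow> nat) set" where
  "bin_vecs n = (\<Pi>\<^sub>E a\<in>{1..n}. {0, 1})"

definition supp :: "nat \<Rightarrow> (nat \<Rightarrow> nat) \<Rightarrow> nat set" where
  "supp n g = {a \<in> {1..n}. g a = 1}"

definition vec_of :: "nat \<Rightarrow> nat set \<Rightarrow> nat \<Rightarrow> nat" where
  "vec_of n V = (\<lambda>a\<in>{1..n}. if a \<in> V then 1 else 0)"

definition preceq :: "nat \<Rightarrow> (nat \<Rightarrow> nat) \<Rightarrow> (nat \<Rightarrow> nat) \<Rightarrow> bool" where
  "preceq n g h \<longleftrightarrow> supp n g \<subseteq> supp n h"

definition vec_inter :: "nat \<Rightarrow> (nat \<Rightarrow> nat) \<Rightarrow> (nat \<Rightarrow> nat) \<Rightarrow> nat \<Rightarrow> nat" where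
  "vec_inter n g h = vec_of n (supp n g \<inter> supp n h)"

text \<open>The set \<open>V\<^sup>\<circ>\<close>.\<close>

definition circ_part :: "(nat \<Rightarrow> 'u set) \<Rightarrow> nat set \<Rightarrow> nat set" where
  "circ_part U V = {a \<in> V. card (U a) > 2}"

text \<open>The product \<open>g i\<close> of two elements of \<open>{0,1}\<^sup>n\<close>.\<close>

definition vec_prod ::
  "nat \<Rightarrow> (nat \<Rightarrow> 'u set) \<Rightarrow> (nat \<Rightarrow> nat) \<Rightarrow> (nat \<Rightarrow> nat) \<Rightarrow> nat \<Rightarrow> nat" where
  "vec_prod n U g i =
    vec_of n (sym_diff (supp n g) (supp n i) \<union> circ_part U (supp n g \<inter> supp n i))"

definition scheme_rel ::
  "nat \<Rightarrow> (nat \<Rightarrow> 'u set) \<Rightarrow> (nat \<Rightarrow> nat) \<Rightarrow> ((nat \<Rightarrow> 'u) \<times> (nat \<Rightarrow> 'u)) set" where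
  "scheme_rel n U g =
    {(y, z) \<in> points n U \<times> points n U. \<forall>a\<in>{1..n}. y a \<noteq> z a \<longleftrightarrow> g a = 1}"

definition valency :: "nat \<Rightarrow> (nat \<Rightarrow> 'u set) \<Rightarrow> (nat \<Rightarrow> nat) \<Rightarrow> nat" where
  "valency n U g = (\<Prod>a\<in>supp n g. card (U a) - 1)"

definition adj_mat ::
  "nat \<Rightarrow> (nat \<Rightarrow> 'u set) \<Rightarrow> (nat \<Rightarrow> nat) \<Rightarrow> (nat \<Rightarrow> 'u) \<Rightarrow> (nat \<Rightarrow> 'u) \<Rightarrow> 'f::field" where
  "adj_mat n U g y z = (if (y, z) \<in> scheme_rel n U g then 1 else 0)"

definition dual_idem ::
  "nat \<Rightarrow> (nat \<Rightarrow> 'u set) \<Rightarrow> (nat \<Rightarrow> 'u) \<Rightarrow> (nat \<Rightarrow> nat)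
    \<Rightarrow> (nat \<Rightarrow> 'u) \<Rightarrow> (nat \<Rightarrow> 'u) \<Rightarrow> 'f::field" where
  "dual_idem n U x g y z = (if y = z \<and> (x, y) \<in> scheme_rel n U g then 1 else 0)"

definition terwilliger ::
  "nat \<Rightarrow> (nat \<Rightarrow> 'u set) \<Rightarrow> (nat \<Rightarrow> 'u)
    \<Rightarrow> ('f::field, (nat \<Rightarrow> 'u) \<Rightarrow> (nat \<Rightarrow> 'u) \<Rightarrow> 'f) module" where
  "terwilliger n U x =
    generated_subalgebra (mat_alg (points n U))
      (adj_mat n U ` bin_vecs n \<union> dual_idem n U x ` bin_vecs n)"

definition triples ::
  "nat \<Rightarrow> (nat \<Rightarrow> 'u set) \<Rightarrow> ((nat \<Rightarrow> nat) \<times> (nat \<Rightarrow> nat) \<times> (nat \<Rightarrow> nat)) set" where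
  "triples n U =
    {(a, b, c) \<in> bin_vecs n \<times> bin_vecs n \<times> bin_vecs n.
      sym_diff (supp n a) (supp n c) \<subseteq> supp n b \<and>
      supp n b \<subseteq> sym_diff (supp n a) (supp n c) \<union> circ_part U (supp n a \<inter> supp n c)}"

definition B_mat ::
  "nat \<Rightarrow> (nat \<Rightarrow> 'u set) \<Rightarrow> (nat \<Rightarrow> 'u) \<Rightarrow> (nat \<Rightarrow> nat) \<Rightarrow> (nat \<Rightarrow> nat) \<Rightarrow> (nat \<Rightarrow> nat)
    \<Rightarrow> (nat \<Rightarrow> 'u) \<Rightarrow> (nat \<Rightarrow> 'u) \<Rightarrow> 'f::field" where
  "B_mat n U x g h i =
    (let M = mat_alg (points n U) in
      \<Oplus>\<^bsub>M\<^esub> j \<in> {j \<in> bin_vecs n. sym_diff (supp n g) (supp n i) \<subseteq> supp n j \<and> supp n j \<subseteq> supp n h}.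
        dual_idem n U x g \<otimes>\<^bsub>M\<^esub> adj_mat n U j \<otimes>\<^bsub>M\<^esub> dual_idem n U x i)"

text \<open>
  In the following two definitions \<open>p\<close> is the characteristic of the field. For a natural
  number \<open>m\<close>, \<open>p dvd m\<close> holds iff the image of \<open>m\<close> in the field is \<open>0\<close>
  (\<open>of_nat_eq_0_iff_char_dvd\<close>), also if \<open>p = 0\<close>.
\<close>

definition n_num ::
  "nat \<Rightarrow> nat \<Rightarrow> (nat \<Rightarrow> 'u set) \<Rightarrow> (nat \<Rightarrow> nat) \<Rightarrow> (nat \<Rightarrow> nat) \<Rightarrow> nat" where
  "n_num p n U f h = card {a \<in> supp n f - supp n h. \<not> p dvd card (U a) - 1}"

definition U_set ::
  "nat \<Rightarrow> nat \<Rightarrow> (nat \<Rightarrow> 'u set) \<Rightarrow> (nat \<Rightarrow> nat) \<Rightarrow> (nat \<Rightarrow> nat) \<Rightarrow> nat \<Rightarrow> (nat \<Rightarrow> nat) set" where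
  "U_set p n U f h k =
    {a \<in> bin_vecs n. preceq n h a \<and> preceq n a f \<and> \<not> p dvd valency n U a \<and>
      card (supp n a - supp n h) = k}"

definition D_mat ::
  "nat \<Rightarrow> (nat \<Rightarrow> 'u set) \<Rightarrow> (nat \<Rightarrow> 'u) \<Rightarrow> (nat \<Rightarrow> nat) \<Rightarrow> (nat \<Rightarrow> nat) \<Rightarrow> (nat \<Rightarrow> nat)
    \<Rightarrow> (nat \<Rightarrow> 'u) \<Rightarrow> (nat \<Rightarrow> 'u) \<Rightarrow> 'f::field" where
  "D_mat n U x g h i =
    (let M = mat_alg (points n U); p = CHAR('f); f = vec_prod n U g i in
      \<Oplus>\<^bsub>M\<^esub> k \<in> {0..n_num p n U f h}. \<Oplus>\<^bsub>M\<^esub> l \<in> U_set p n U f h k.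
        ((- 1) ^ k * inverse (of_nat (valency n U (vec_inter n i l)))) \<odot>\<^bsub>M\<^esub> B_mat n U x g l i)"

definition terwilliger_head ::
  "nat \<Rightarrow> (nat \<Rightarrow> 'u set) \<Rightarrow> (nat \<Rightarrow> 'u)
    \<Rightarrow> ('f::field, ((nat \<Rightarrow> 'u) \<Rightarrow> (nat \<Rightarrow> 'u) \<Rightarrow> 'f) set) module" where
  "terwilliger_head n U x =
    quotient_algebra (terwilliger n U x) (jacobson_radical (terwilliger n U x))"

end

theory Submission
  imports Defs
begin

text \<open>
  The matrices in the algebra are tensor products over the \<open>n\<close> factors. For one factor with
  \<open>k = |U| - 1\<close>, the Terwilliger algebra has a basis in which the product of two elements is zero
  or again a basis element: if \<open>k\<close> is invertible in the field, this basis consists of matrix units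
  of \<open>M\<^sub>2 \<times> F\<close> (or \<open>M\<^sub>2\<close>, if \<open>|U| = 2\<close>); otherwise the blocks of the all-ones matrix other than
  the \<open>1 \<times> 1\<close> block span an ideal with vanishing cube. Tensoring gives a multiplicative basis \<open>W\<close>
  of the whole algebra. The basis elements \<open>W s\<close> having a factor from such an ideal span a sum of
  nilpotent ideals, which therefore lies in the radical; the remaining ones are the matrices \<open>D\<close>
  and multiply like matrix units, so every column of them yields a maximal left ideal, and the
  intersection of these is the span of the former.
\<close>

section \<open>The matrix algebra\<close>

text \<open>The formula for D is a tensor expansion. At a coordinate with \<open>g\<close>,
  \<open>i\<close> and no \<open>h\<close>, where k is invertible and there are at least three
  points, the local factor is I - J/k on the points other than the base point (J all ones); where
  \<open>h\<close> holds it is an all-ones block, divided by k if \<open>i\<close> holds.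
  Multiplying out, \<open>l\<close> records the coordinates where J was taken: the sign comes from
  those outside \<open>h\<close>, the inverse of the valency of i \<inter> l from the
  normalisations. The obstacle is that p may divide |U_a| - 1 for some coordinates and not for
  others, so that semisimple and non-semisimple local algebras are mixed. Indexing both kinds of
  local bases by the same boolean triples lets one tensor basis cover all mixtures. The radical is
  given through maximal left ideals, so nilpotence enters only in this form: a left ideal whose
  pairwise products lie in a maximal left ideal is contained in it. An ideal of vanishing cube takes
  two such steps.\<close>

lemma mat_alg_simps [simp]:
  "carrier (mat_alg X) = {A. \<forall>y z. (y, z) \<notin> X \<times> X \<longrightarrow> A y z = 0}"
  "A \<otimes>\<^bsub>mat_alg X\<^esub> B = (\<lambda>y z. \<Sum>w\<in>X. A y w * B w z)"
  "\<one>\<^bsub>mat_alg X\<^esub> = (\<lambda>y z. if y \<in> X \<and> y = z then 1 else 0)"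
  "\<zero>\<^bsub>mat_alg X\<^esub> = (\<lambda>y z. 0)"
  "A \<oplus>\<^bsub>mat_alg X\<^esub> B = (\<lambda>y z. A y z + B y z)"
  "c \<odot>\<^bsub>mat_alg X\<^esub> A = (\<lambda>y z. c * A y z)"
  by (simp_all add: mat_alg_def)

lemma ring_mat_alg:
  assumes "finite X"
  shows "ring (mat_alg X :: ('f::field, 'x \<Rightarrow> 'x \<Rightarrow> 'f) module)"
proof (rule ringI)
  show "abelian_group (mat_alg X :: ('f, 'x \<Rightarrow> 'x \<Rightarrow> 'f) module)"
  proof (rule abelian_groupI)
    fix A :: "'x \<Rightarrow> 'x \<Rightarrow> 'f"
    assume "A \<in> carrier (mat_alg X)"
    then show "\<exists>B\<in>carrier (mat_alg X). B \<oplus>\<^bsub>mat_alg X\<^esub> A = \<zero>\<^bsub>mat_alg X\<^esub>"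
      by (intro bexI[of _ "\<lambda>y z. - A y z"]) auto
  qed (auto simp: add_ac)
  show "Group.monoid (mat_alg X :: ('f, 'x \<Rightarrow> 'x \<Rightarrow> 'f) module)"
  proof (rule monoidI)
    fix A B C :: "'x \<Rightarrow> 'x \<Rightarrow> 'f"
    show "A \<otimes>\<^bsub>mat_alg X\<^esub> B \<otimes>\<^bsub>mat_alg X\<^esub> C = A \<otimes>\<^bsub>mat_alg X\<^esub> (B \<otimes>\<^bsub>mat_alg X\<^esub> C)"
      by (auto simp: fun_eq_iff sum_distrib_left sum_distrib_right mult.assoc intro: sum.swap)
  next
    fix A :: "'x \<Rightarrow> 'x \<Rightarrow> 'f"
    assume "A \<in> carrier (mat_alg X)"
    then have A: "A y z = 0" if "y \<notin> X \<or> z \<notin> X" for y z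
      using that by auto
    have "(\<Sum>w\<in>X. (if y \<in> X \<and> y = w then 1 else 0) * A w z) = A y z"
      "(\<Sum>w\<in>X. A y w * (if w \<in> X \<and> w = z then 1 else 0)) = A y z" for y z
      using assms A by (cases "y \<in> X"; cases "z \<in> X"; simp add: if_distrib[of "\<lambda>t. t * _"]
          if_distrib[of "\<lambda>t. _ * t"] cong: if_cong conj_cong)+
    then show "\<one>\<^bsub>mat_alg X\<^esub> \<otimes>\<^bsub>mat_alg X\<^esub> A = A" "A \<otimes>\<^bsub>mat_alg X\<^esub> \<one>\<^bsub>mat_alg X\<^esub> = A"
      by (simp_all add: fun_eq_iff)
  qed auto
qed (auto simp: fun_eq_iff distrib_left distrib_right sum.distrib)

lemma finsum_mat_alg:
  fixes f :: "'s \<Rightarrow> 'x \<Rightarrow> 'x \<Rightarrow> 'f::field"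
  assumes "finite X" "finite S" "\<And>s. s \<in> S \<Longrightarrow> f s \<in> carrier (mat_alg X)"
  shows "finsum (mat_alg X) f S = (\<lambda>y z. \<Sum>s\<in>S. f s y z)"
proof -
  interpret ring "mat_alg X :: ('f, 'x \<Rightarrow> 'x \<Rightarrow> 'f) module"
    by (rule ring_mat_alg[OF assms(1)])
  show ?thesis
    using assms(2,3)
  proof (induction S rule: finite_induct)
    case empty
    then show ?case using finsum_empty by auto
  next
    case (insert s S)
    then have "finsum (mat_alg X) f (insert s S) = f s \<oplus>\<^bsub>mat_alg X\<^esub> finsum (mat_alg X) f S"
      by (intro finsum_insert) auto
    then show ?case
      using insert by (simp del: mat_alg_simps(1))
  qed
qed

text \<open>Products and the identity stay folded from here on, so that rules about products of
  basis elements can match; sums and scalar multiples still unfold pointwise.\<close>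

declare mat_alg_simps(2,3) [simp del]

section \<open>Left ideals, quotient algebras and bases\<close>

text \<open>If K were not inside M, maximality would make M + K the whole ring, so 1 = m + k; then w
  = w m + w k lies in M for every w in K. This is how nilpotent pieces are pushed into the
  radical.\<close>

lemma square_subset_maximal_left_ideal:
  assumes "ring R" and K: "left_ideal K R" and M: "maximal_left_ideal M R"
    and KK: "\<And>v w. v \<in> K \<Longrightarrow> w \<in> K \<Longrightarrow> v \<otimes>\<^bsub>R\<^esub> w \<in> M"
  shows "K \<subseteq> M"
proof (rule ccontr)
  assume "\<not> K \<subseteq> M"
  interpret R: ring R by fact
  have M': "left_ideal M R" using M by (simp add: maximal_left_ideal_def)
  interpret M: additive_subgroup M R using M' by (simp add: left_ideal_def)
  interpret K: additive_subgroup K R using K by (simp add: left_ideal_def)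
  let ?S = "M <+>\<^bsub>R\<^esub> K"
  have mem: "x \<in> ?S \<longleftrightarrow> (\<exists>m\<in>M. \<exists>k\<in>K. x = m \<oplus>\<^bsub>R\<^esub> k)" for x
    by (auto simp: set_add_def set_mult_def)
  have "additive_subgroup ?S R"
    by (rule R.add_additive_subgroups) (use M' K in \<open>auto simp: left_ideal_def\<close>)
  moreover have "r \<otimes>\<^bsub>R\<^esub> a \<in> ?S" if "r \<in> carrier R" "a \<in> ?S" for r a
  proof -
    obtain m k where "m \<in> M" "k \<in> K" "a = m \<oplus>\<^bsub>R\<^esub> k" using \<open>a \<in> ?S\<close> mem by blast
    then show ?thesis
      using that M' K unfolding mem left_ideal_def
      by (intro bexI[of _ "r \<otimes>\<^bsub>R\<^esub> m"] bexI[of _ "r \<otimes>\<^bsub>R\<^esub> k"]) (auto simp: R.r_distr)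
  qed
  ultimately have S: "left_ideal ?S R" by (simp add: left_ideal_def)
  have "M \<subseteq> ?S"
    unfolding subset_iff mem using M.a_subset K.zero_closed
    by (metis R.r_zero subset_iff)
  moreover have "K \<subseteq> ?S"
    unfolding subset_iff mem using K.a_subset M.zero_closed
    by (metis R.l_zero subset_iff)
  ultimately have "?S = carrier R"
    using M S \<open>\<not> K \<subseteq> M\<close> unfolding maximal_left_ideal_def by blast
  then obtain m k where mk: "m \<in> M" "k \<in> K" "\<one>\<^bsub>R\<^esub> = m \<oplus>\<^bsub>R\<^esub> k"
    using mem R.one_closed by metis
  have "w \<in> M" if w: "w \<in> K" for w
  proof -
    have "w = w \<otimes>\<^bsub>R\<^esub> (m \<oplus>\<^bsub>R\<^esub> k)" using w mk(3)[symmetric] by simp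
    also have "\<dots> = w \<otimes>\<^bsub>R\<^esub> m \<oplus>\<^bsub>R\<^esub> w \<otimes>\<^bsub>R\<^esub> k" using w mk by (simp add: R.r_distr)
    also have "\<dots> \<in> M" using w mk KK M' by (intro M.a_closed) (auto simp: left_ideal_def)
    finally show ?thesis .
  qed
  with \<open>\<not> K \<subseteq> M\<close> show False by blast
qed

lemma quotient_algebra_simps:
  "carrier (quotient_algebra M I) = a_rcosets\<^bsub>M\<^esub> I"
  "zero (quotient_algebra M I) = I"
  "add (quotient_algebra M I) = set_add M"
  "smult (quotient_algebra M I) = (\<lambda>c C. \<Union>a\<in>C. I +>\<^bsub>M\<^esub> (c \<odot>\<^bsub>M\<^esub> a))"
  by (simp_all add: quotient_algebra_def FactRing_def ring.defs module.defs)

text \<open>The scalar multiple of a coset is defined as a union over all its representatives. Two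
  representatives differ by some i in I, and c i stays in I, so the union is over a constant,
  nonempty family.\<close>

lemma quotient_algebra_smult_coset:
  assumes "Module.module (class_ring :: 'f::field ring) M" "ideal I M"
    and I: "\<And>c v. v \<in> I \<Longrightarrow> c \<odot>\<^bsub>M\<^esub> v \<in> I" and v: "v \<in> carrier M"
  shows "c \<odot>\<^bsub>quotient_algebra M I\<^esub> (I +>\<^bsub>M\<^esub> v) = I +>\<^bsub>M\<^esub> (c \<odot>\<^bsub>M\<^esub> v)"
proof -
  interpret Module.module "class_ring :: 'f ring" M by fact
  interpret I: ideal I M by fact
  have "I +>\<^bsub>M\<^esub> (c \<odot>\<^bsub>M\<^esub> w) = I +>\<^bsub>M\<^esub> (c \<odot>\<^bsub>M\<^esub> v)" if w: "w \<in> I +>\<^bsub>M\<^esub> v" for w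
  proof -
    obtain i where i: "i \<in> I" "w = i \<oplus>\<^bsub>M\<^esub> v"
      using w by (auto simp: a_r_coset_def')
    then have "c \<odot>\<^bsub>M\<^esub> w = c \<odot>\<^bsub>M\<^esub> i \<oplus>\<^bsub>M\<^esub> c \<odot>\<^bsub>M\<^esub> v"
      using v by (simp add: smult_r_distr)
    then have "c \<odot>\<^bsub>M\<^esub> w \<in> I +>\<^bsub>M\<^esub> (c \<odot>\<^bsub>M\<^esub> v)"
      using I[OF i(1)] by (auto simp: a_r_coset_def')
    then show ?thesis
      using I.a_repr_independence'[of "c \<odot>\<^bsub>M\<^esub> w" "c \<odot>\<^bsub>M\<^esub> v"] v by simp
  qed
  then have "(\<Union>w\<in>I +>\<^bsub>M\<^esub> v. I +>\<^bsub>M\<^esub> (c \<odot>\<^bsub>M\<^esub> w)) = (\<Union>w\<in>I +>\<^bsub>M\<^esub> v. I +>\<^bsub>M\<^esub> (c \<odot>\<^bsub>M\<^esub> v))"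
    by (rule SUP_cong[OF refl])
  also have "\<dots> = I +>\<^bsub>M\<^esub> (c \<odot>\<^bsub>M\<^esub> v)"
    using I.a_rcos_self[OF v] by (auto simp only: UN_constant split: if_splits)
  finally show ?thesis
    unfolding quotient_algebra_simps .
qed

lemma vectorspace_quotient_algebra:
  assumes M: "Module.module (class_ring :: 'f::field ring) M" and I: "ideal I M"
    and smI: "\<And>c v. v \<in> I \<Longrightarrow> c \<odot>\<^bsub>M\<^esub> v \<in> I"
  shows "vectorspace (class_ring :: 'f ring) (quotient_algebra M I)"
proof -
  interpret Module.module "class_ring :: 'f ring" M by fact
  interpret I: ideal I M by fact
  interpret Q: ring "M Quot I" by (rule I.quotient_is_ring)
  let ?Q = "quotient_algebra M I"
  note smult = quotient_algebra_smult_coset[OF M I smI]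
  have coset: "\<exists>v\<in>carrier M. C = I +>\<^bsub>M\<^esub> v" if "C \<in> carrier ?Q" for C
    using that by (auto simp: quotient_algebra_simps A_RCOSETS_def')
  have cosetI: "I +>\<^bsub>M\<^esub> v \<in> carrier ?Q" if "v \<in> carrier M" for v
    using that by (simp add: quotient_algebra_simps M.a_rcosetsI I.a_subset)
  have sum: "(I +>\<^bsub>M\<^esub> v) \<oplus>\<^bsub>?Q\<^esub> (I +>\<^bsub>M\<^esub> w) = I +>\<^bsub>M\<^esub> (v \<oplus>\<^bsub>M\<^esub> w)"
    if "v \<in> carrier M" "w \<in> carrier M" for v w
    using that by (simp add: quotient_algebra_simps I.a_rcos_sum)
  have "abelian_group ?Q"
  proof (rule abelian_groupI)
    fix C assume "C \<in> carrier ?Q"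
    then show "\<exists>B\<in>carrier ?Q. B \<oplus>\<^bsub>?Q\<^esub> C = \<zero>\<^bsub>?Q\<^esub>"
      using Q.add.l_inv_ex[of C] by (simp add: quotient_algebra_simps FactRing_def)
  qed (use Q.add.m_closed Q.add.m_assoc Q.add.m_comm Q.zero_closed Q.l_zero
      in \<open>simp_all add: quotient_algebra_simps FactRing_def\<close>)
  then have "Module.module (class_ring :: 'f ring) ?Q"
  proof (rule moduleI[OF class_cring.is_cring], goal_cases)
    case (1 a C)
    then show ?case using coset[OF 1(2)] smult cosetI by (auto)
  next
    case (2 a b C)
    then obtain v where v: "v \<in> carrier M" "C = I +>\<^bsub>M\<^esub> v" using coset by blast
    then show ?case using smult_l_distr[of a b v] by (simp add: smult sum)
  next
    case (3 a B C)
    then obtain v w where v: "v \<in> carrier M" "B = I +>\<^bsub>M\<^esub> v" "w \<in> carrier M" "C = I +>\<^bsub>M\<^esub> w"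
      using coset by meson
    then show ?case using smult_r_distr[of a v w] by (simp add: smult sum)
  next
    case (4 a b C)
    then obtain v where v: "v \<in> carrier M" "C = I +>\<^bsub>M\<^esub> v" using coset by blast
    then show ?case using smult_assoc1[of a b v] by (simp add: smult)
  next
    case (5 C)
    then obtain v where v: "v \<in> carrier M" "C = I +>\<^bsub>M\<^esub> v" using coset by blast
    then show ?case using smult_one[of v] by (simp add: smult)
  qed
  then show ?thesis
    using class_field by (rule vectorspace.intro)
qed

text \<open>Passes from an indexed family to the set-based notion \<open>basis\<close>. Injectivity
  has to be extracted from independence of the family, as equal members would collapse in the image;
  it also serves later for counting.\<close>

lemma basis_image:
  assumes "vectorspace (class_ring :: 'f::field ring) V"
    and G: "finite G" "\<And>s. s \<in> G \<Longrightarrow> w s \<in> carrier V"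
    and gen: "\<And>v. v \<in> carrier V \<Longrightarrow> \<exists>c :: _ \<Rightarrow> 'f. v = (\<Oplus>\<^bsub>V\<^esub>s\<in>G. c s \<odot>\<^bsub>V\<^esub> w s)"
    and ind: "\<And>(c :: _ \<Rightarrow> 'f) s. (\<Oplus>\<^bsub>V\<^esub>s\<in>G. c s \<odot>\<^bsub>V\<^esub> w s) = \<zero>\<^bsub>V\<^esub> \<Longrightarrow> s \<in> G \<Longrightarrow> c s = 0"
  shows "inj_on w G" "vectorspace.basis (class_ring :: 'f ring) V (w ` G)"
proof -
  interpret vectorspace "class_ring :: 'f ring" V by fact
  have sm: "c \<odot>\<^bsub>V\<^esub> w s \<in> carrier V" if "s \<in> G" for c :: 'f and s
    using that G by simp
  have sub: "(\<Oplus>\<^bsub>V\<^esub>s\<in>G. (if s \<in> H then c s else 0) \<odot>\<^bsub>V\<^esub> w s) = (\<Oplus>\<^bsub>V\<^esub>s\<in>H. c s \<odot>\<^bsub>V\<^esub> w s)"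
    if "H \<subseteq> G" for H and c :: "_ \<Rightarrow> 'f"
    by (rule add.finprod_mono_neutral_cong_right) (use that G sm smult_l_null in auto)
  show inj: "inj_on w G"
  proof (rule inj_onI, rule ccontr)
    fix s t assume st: "s \<in> G" "t \<in> G" "w s = w t" "s \<noteq> t"
    \<comment> \<open>Coefficients 1 and -1 on two indices with equal vectors would be a nontrivial
      relation.\<close>
    let ?c = "\<lambda>u. if u = s then (1::'f) else - 1"
    have "(\<Oplus>\<^bsub>V\<^esub>u\<in>G. (if u \<in> {s,t} then ?c u else 0) \<odot>\<^bsub>V\<^esub> w u) =
        (\<Oplus>\<^bsub>V\<^esub>u\<in>{s,t}. ?c u \<odot>\<^bsub>V\<^esub> w u)"
      by (rule sub) (use st in simp)
    also have "\<dots> = 1 \<odot>\<^bsub>V\<^esub> w s \<oplus>\<^bsub>V\<^esub> (- 1) \<odot>\<^bsub>V\<^esub> w t"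
      using st sm by (subst finsum_insert) (auto simp: finsum_insert)
    also have "\<dots> = (1 + (- 1)) \<odot>\<^bsub>V\<^esub> w s"
      using st G smult_l_distr[of 1 "- 1" "w s"] by simp
    also have "\<dots> = \<zero>\<^bsub>V\<^esub>"
      using st G smult_l_null[of "w s"] by simp
    finally have "(\<Oplus>\<^bsub>V\<^esub>u\<in>G. (if u \<in> {s,t} then ?c u else 0) \<odot>\<^bsub>V\<^esub> w u) = \<zero>\<^bsub>V\<^esub>" .
    from ind[OF this st(1)] show False by simp
  qed
  have lincomb: "lincomb a (w ` H) = (\<Oplus>\<^bsub>V\<^esub>s\<in>H. a (w s) \<odot>\<^bsub>V\<^esub> w s)" if "H \<subseteq> G" for a H
    unfolding lincomb_def
    by (rule add.finprod_reindex) (use that G inj in \<open>auto intro: inj_on_subset\<close>)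
  have "lin_indpt (w ` G)"
  proof
    assume "lin_dep (w ` G)"
    then obtain A a v where A: "finite A" "A \<subseteq> w ` G" "lincomb a A = \<zero>\<^bsub>V\<^esub>" "v \<in> A" "a v \<noteq> 0"
      unfolding lin_dep_def by auto
    from A(2) obtain H where H: "H \<subseteq> G" "A = w ` H" by (meson subset_imageE)
    then obtain s where s: "s \<in> H" "v = w s" using A by auto
    have "(\<Oplus>\<^bsub>V\<^esub>s\<in>G. (if s \<in> H then a (w s) else 0) \<odot>\<^bsub>V\<^esub> w s) = \<zero>\<^bsub>V\<^esub>"
      unfolding sub[OF H(1)] using A(3) lincomb[OF H(1), of a] unfolding H(2) by simp
    from ind[OF this, of s] show False using s H A by auto
  qed
  moreover have "carrier V \<subseteq> span (w ` G)"
  proof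
    fix v assume "v \<in> carrier V"
    then obtain c where c: "v = (\<Oplus>\<^bsub>V\<^esub>s\<in>G. c s \<odot>\<^bsub>V\<^esub> w s)" using gen by blast
    have "v = lincomb (\<lambda>u. c (inv_into G w u)) (w ` G)"
      unfolding lincomb[OF order_refl] c
      by (rule finsum_cong') (use G sm inj in \<open>auto simp: inv_into_f_f\<close>)
    then show "v \<in> span (w ` G)"
      using G by (auto simp: span_def)
  qed
  moreover have "span (w ` G) \<subseteq> carrier V" "w ` G \<subseteq> carrier V"
    using G by (auto intro!: span_is_subset2)
  ultimately show "basis (w ` G)"
    unfolding basis_def by (intro conjI equalityI)
qed

section \<open>Algebras with a multiplicative basis\<close>

lemma mat_mult_sum_left:
  "(\<lambda>y z. \<Sum>s\<in>S. c s * A s y z) \<otimes>\<^bsub>mat_alg X\<^esub> B = (\<lambda>y z. \<Sum>s\<in>S. c s * (A s \<otimes>\<^bsub>mat_alg X\<^esub> B) y z)"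
  by (auto simp: mat_alg_simps fun_eq_iff sum_distrib_left sum_distrib_right mult_ac intro: sum.swap)

lemma mat_mult_sum_right:
  "B \<otimes>\<^bsub>mat_alg X\<^esub> (\<lambda>y z. \<Sum>s\<in>S. c s * A s y z) = (\<lambda>y z. \<Sum>s\<in>S. c s * (B \<otimes>\<^bsub>mat_alg X\<^esub> A s) y z)"
  by (auto simp: mat_alg_simps fun_eq_iff sum_distrib_left sum_distrib_right mult_ac intro: sum.swap)

text \<open>
  The set \<open>G\<close> indexes the basis elements that survive in the head. There they behave like the
  matrix units of a product of matrix algebras, \<open>r s\<close> being the diagonal unit in the column
  of \<open>s\<close> and \<open>i s\<close> the transpose of \<open>s\<close>.
\<close>

locale multiplicative_basis =
  fixes X :: "'x set" and P G :: "'s set" and W :: "'s \<Rightarrow> 'x \<Rightarrow> 'x \<Rightarrow> 'f::field"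
    and r i :: "'s \<Rightarrow> 's"
  assumes finite_X: "finite X" and finite_P: "finite P" and G_subset: "G \<subseteq> P"
    and W_carrier: "\<And>s. s \<in> P \<Longrightarrow> W s \<in> carrier (mat_alg X)"
    and W_indep: "\<And>c s. (\<lambda>y z. \<Sum>s\<in>P. c s * W s y z) = (\<lambda>y z. 0) \<Longrightarrow> s \<in> P \<Longrightarrow> c s = 0"
    and W_mult: "\<And>q t. q \<in> P \<Longrightarrow> t \<in> P \<Longrightarrow> W q \<otimes>\<^bsub>mat_alg X\<^esub> W t = (\<lambda>y z. 0) \<or>
      (\<exists>u\<in>P. W q \<otimes>\<^bsub>mat_alg X\<^esub> W t = W u \<and> (u \<in> G \<longrightarrow> q \<in> G \<and> t \<in> G \<and> r u = r t))"
    and W_inverse: "\<And>s. s \<in> G \<Longrightarrow> i s \<in> P \<and> W (i s) \<otimes>\<^bsub>mat_alg X\<^esub> W s = W (r s)"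
    and W_annihil: "\<And>s t. s \<in> G \<Longrightarrow> t \<in> G \<Longrightarrow> r t = r s \<Longrightarrow> t \<noteq> s \<Longrightarrow>
      W (i s) \<otimes>\<^bsub>mat_alg X\<^esub> W t = (\<lambda>y z. 0)"
    and r_idem: "\<And>s. s \<in> G \<Longrightarrow> r s \<in> G \<and> r (r s) = r s"
    and W_one: "\<one>\<^bsub>mat_alg X\<^esub> = (\<lambda>y z. \<Sum>e\<in>{e \<in> G. r e = e}. W e y z)"
    and W_nil: "\<And>s. s \<in> P - G \<Longrightarrow> \<exists>K N. s \<in> K \<and> K \<subseteq> P \<and> N \<subseteq> P \<and>
      (\<forall>q\<in>P. \<forall>t\<in>K. W q \<otimes>\<^bsub>mat_alg X\<^esub> W t \<in> insert (\<lambda>y z. 0) (W ` K)) \<and>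
      (\<forall>q\<in>P. \<forall>t\<in>N. W q \<otimes>\<^bsub>mat_alg X\<^esub> W t \<in> insert (\<lambda>y z. 0) (W ` N)) \<and>
      (\<forall>q\<in>K. \<forall>t\<in>K. W q \<otimes>\<^bsub>mat_alg X\<^esub> W t \<in> insert (\<lambda>y z. 0) (W ` N)) \<and>
      (\<forall>q\<in>N. \<forall>t\<in>N. W q \<otimes>\<^bsub>mat_alg X\<^esub> W t = (\<lambda>y z. 0))"
begin

section \<open>Spans of basis elements as subrings and left ideals\<close>

definition lspan :: "'s set \<Rightarrow> ('x \<Rightarrow> 'x \<Rightarrow> 'f) set" where
  "lspan Q = range (\<lambda>c y z. \<Sum>s\<in>Q. c s * W s y z)"

text \<open>A carrier update of \<open>mat_alg\<close>, the very shape produced by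
  \<open>generated_subalgebra\<close>, so that \<open>terwilliger\<close> can be equal to it as a
  record.\<close>

definition T :: "('f, 'x \<Rightarrow> 'x \<Rightarrow> 'f) module" where
  "T = (mat_alg X)\<lparr>carrier := lspan P\<rparr>"

lemma T_simps [simp]:
  "carrier T = lspan P" "mult T = mult (mat_alg X)" "one T = one (mat_alg X)"
  "zero T = zero (mat_alg X)" "add T = add (mat_alg X)" "smult T = smult (mat_alg X)"
  by (simp_all add: T_def)

lemma lspanI: "(\<lambda>y z. \<Sum>s\<in>Q. c s * W s y z) \<in> lspan Q"
  by (auto simp: lspan_def)

lemma lspanE:
  assumes "A \<in> lspan Q"
  obtains c where "A = (\<lambda>y z. \<Sum>s\<in>Q. c s * W s y z)"
  using assms by (auto simp: lspan_def)

lemma lspan_zero: "(\<lambda>y z. 0) \<in> lspan Q"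
  using lspanI[of "\<lambda>_. 0" Q] by simp

lemma lspan_add: "A \<in> lspan Q \<Longrightarrow> B \<in> lspan Q \<Longrightarrow> (\<lambda>y z. A y z + B y z) \<in> lspan Q"
  by (elim lspanE, simp only: sum.distrib[symmetric] distrib_right[symmetric], rule lspanI)

lemma lspan_smult: "A \<in> lspan Q \<Longrightarrow> (\<lambda>y z. c * A y z) \<in> lspan Q"
  by (elim lspanE, simp only: sum_distrib_left mult.assoc[symmetric], rule lspanI)

lemma lspan_sum:
  assumes "\<And>s. s \<in> S \<Longrightarrow> A s \<in> lspan Q"
  shows "(\<lambda>y z. \<Sum>s\<in>S. c s * A s y z) \<in> lspan Q"
  using assms
  by (induction S rule: infinite_finite_induct) (auto intro!: lspan_zero lspan_add lspan_smult)

lemma W_in_lspan: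
  assumes "finite Q" "s \<in> Q" shows "W s \<in> lspan Q"
  using lspanI[of "\<lambda>t. if t = s then 1 else 0" Q] assms
  by (simp add: if_distrib[of "\<lambda>t. t * _"] cong: if_cong)

lemma insert_W_in_lspan: "finite Q \<Longrightarrow> A \<in> insert (\<lambda>y z. 0) (W ` Q) \<Longrightarrow> A \<in> lspan Q"
  using W_in_lspan lspan_zero by blast

lemma lspan_mono:
  assumes "Q \<subseteq> Q'" "finite Q'"
  shows "lspan Q \<subseteq> lspan Q'"
proof
  fix A assume "A \<in> lspan Q"
  then obtain c where "A = (\<lambda>y z. \<Sum>s\<in>Q. c s * W s y z)" by (rule lspanE)
  then show "A \<in> lspan Q'"
    using assms by (auto intro!: lspan_sum W_in_lspan)
qed

lemma lspan_subset: "Q \<subseteq> P \<Longrightarrow> lspan Q \<subseteq> lspan P"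
  using lspan_mono finite_P by blast

lemma lspan_carrier: "lspan P \<subseteq> carrier (mat_alg X)"
  using W_carrier by (auto elim!: lspanE)

lemma lspan_mult:
  assumes "\<And>q t. q \<in> Q \<Longrightarrow> t \<in> Q' \<Longrightarrow> W q \<otimes>\<^bsub>mat_alg X\<^esub> W t \<in> lspan Q''"
    and "A \<in> lspan Q" "B \<in> lspan Q'"
  shows "A \<otimes>\<^bsub>mat_alg X\<^esub> B \<in> lspan Q''"
  using assms(2,3)
  by (elim lspanE) (auto simp: mat_mult_sum_left mat_mult_sum_right intro!: lspan_sum assms(1))

lemma lspan_mult_W:
  assumes "finite Q''"
    and "\<And>q t. q \<in> Q \<Longrightarrow> t \<in> Q' \<Longrightarrow> W q \<otimes>\<^bsub>mat_alg X\<^esub> W t \<in> insert (\<lambda>y z. 0) (W ` Q'')"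
    and "A \<in> lspan Q" "B \<in> lspan Q'"
  shows "A \<otimes>\<^bsub>mat_alg X\<^esub> B \<in> lspan Q''"
  by (rule lspan_mult[OF insert_W_in_lspan[OF assms(1,2)] assms(3,4)])

text \<open>Extending the coefficients by zero from \<open>Q\<close> to \<open>P\<close> brings this
  back to \<open>W_indep\<close>.\<close>

lemma lspan_eq_zero_iff:
  assumes "Q \<subseteq> P" "(\<lambda>y z. \<Sum>s\<in>Q. c s * W s y z) = (\<lambda>y z. 0)" "s \<in> Q"
  shows "c s = 0"
proof -
  have "(\<lambda>y z. \<Sum>s\<in>P. (if s \<in> Q then c s else 0) * W s y z) = (\<lambda>y z. \<Sum>s\<in>Q. c s * W s y z)"
    using assms finite_P by (intro ext sum.mono_neutral_cong_right) auto
  then show ?thesis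
    using W_indep[of "\<lambda>s. if s \<in> Q then c s else 0" s] assms by auto
qed

lemma ring_mat: "ring (mat_alg X :: ('f, 'x \<Rightarrow> 'x \<Rightarrow> 'f) module)"
  by (rule ring_mat_alg[OF finite_X])

lemma mat_uminus:
  assumes "A \<in> carrier (mat_alg X)"
  shows "\<ominus>\<^bsub>mat_alg X\<^esub> A = (\<lambda>y z. (- 1) * A y z :: 'f)"
proof -
  interpret ring "mat_alg X :: ('f, 'x \<Rightarrow> 'x \<Rightarrow> 'f) module" by (rule ring_mat)
  show ?thesis by (rule minus_equality) (use assms in auto)
qed

lemma lspan_P_mult: "A \<in> lspan P \<Longrightarrow> B \<in> lspan P \<Longrightarrow> A \<otimes>\<^bsub>mat_alg X\<^esub> B \<in> lspan P"
  by (rule lspan_mult_W[OF finite_P, of P P]) (use W_mult in blast)+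

lemma lspan_G_sum: "Q \<subseteq> G \<Longrightarrow> (\<lambda>y z. \<Sum>e\<in>Q. W e y z) \<in> lspan Q"
  using lspanI[of "\<lambda>_. 1" Q] by simp

lemma subring_lspan: "subring (lspan P) (mat_alg X)"
proof -
  interpret ring "mat_alg X :: ('f, 'x \<Rightarrow> 'x \<Rightarrow> 'f) module" by (rule ring_mat)
  show ?thesis
  proof (rule subringI)
    show "\<one>\<^bsub>mat_alg X\<^esub> \<in> lspan P"
      unfolding W_one using lspan_G_sum[of "{e \<in> G. r e = e}"] lspan_subset[of "{e \<in> G. r e = e}"]
        G_subset by blast
    show "\<ominus>\<^bsub>mat_alg X\<^esub> A \<in> lspan P" if "A \<in> lspan P" for A
      using mat_uminus[of A] lspan_carrier lspan_smult[OF that, of "- 1"] that by auto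
    show "A \<oplus>\<^bsub>mat_alg X\<^esub> B \<in> lspan P" if "A \<in> lspan P" "B \<in> lspan P" for A B
      using lspan_add[OF that] by simp
  qed (fact lspan_carrier lspan_P_mult)+
qed

lemma is_subalgebra_lspan: "is_subalgebra (lspan P) (mat_alg X)"
  using subring_lspan lspan_smult by (simp add: is_subalgebra_def)

lemma ring_T: "ring T"
  unfolding T_def using ring.subring_is_ring[OF ring_mat subring_lspan] .

lemma one_in_lspan: "\<one>\<^bsub>mat_alg X\<^esub> \<in> lspan P"
  using subringE(3)[OF subring_lspan] .

lemma module_T: "Module.module (class_ring :: 'f ring) T"
proof -
  interpret ring T by (rule ring_T)
  show ?thesis
    by (rule moduleI[OF class_cring.is_cring is_abelian_group])
      (auto simp: lspan_smult distrib_left distrib_right mult.assoc)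
qed

lemma additive_subgroup_lspan:
  assumes "Q \<subseteq> P" shows "additive_subgroup (lspan Q) T"
proof (rule additive_subgroup.intro)
  interpret ring T by (rule ring_T)
  show "subgroup (lspan Q) (add_monoid T)"
  proof (rule add.subgroupI)
    show "lspan Q \<subseteq> carrier T" using lspan_subset[OF assms] by simp
    show "lspan Q \<noteq> {}" using lspan_zero by blast
    show "A \<oplus>\<^bsub>T\<^esub> B \<in> lspan Q" if "A \<in> lspan Q" "B \<in> lspan Q" for A B
      using lspan_add[OF that] by simp
    fix A assume A: "A \<in> lspan Q"
    have "\<ominus>\<^bsub>T\<^esub> A = (\<lambda>y z. (- 1) * A y z)"
      by (rule minus_equality) (use A lspan_subset[OF assms] lspan_smult[OF A, of "- 1"] in auto)
    then show "\<ominus>\<^bsub>T\<^esub> A \<in> lspan Q" using lspan_smult[OF A, of "- 1"] by simp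
  qed
qed

lemma left_ideal_lspan:
  assumes "Q \<subseteq> P"
    and "\<And>q t. q \<in> P \<Longrightarrow> t \<in> Q \<Longrightarrow> W q \<otimes>\<^bsub>mat_alg X\<^esub> W t \<in> insert (\<lambda>y z. 0) (W ` Q)"
  shows "left_ideal (lspan Q) T"
  using additive_subgroup_lspan[OF assms(1)] lspan_mult_W[OF finite_subset[OF assms(1) finite_P] assms(2)]
  by (auto simp: left_ideal_def)

lemma left_ideal_mult:
  "left_ideal J T \<Longrightarrow> A \<in> lspan P \<Longrightarrow> B \<in> J \<Longrightarrow> A \<otimes>\<^bsub>mat_alg X\<^esub> B \<in> J"
  by (simp add: left_ideal_def)

lemma left_ideal_subset: "left_ideal J T \<Longrightarrow> J \<subseteq> lspan P"
  using additive_subgroup.a_subset[of J T] by (simp add: left_ideal_def)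

lemma left_ideal_add:
  assumes "left_ideal J T" "A \<in> J" "B \<in> J"
  shows "(\<lambda>y z. A y z + B y z) \<in> J"
  using additive_subgroup.a_closed[of J T A B] assms by (simp add: left_ideal_def)

lemma left_ideal_zero: "left_ideal J T \<Longrightarrow> (\<lambda>y z. 0) \<in> J"
  using additive_subgroup.zero_closed[of J T] by (simp add: left_ideal_def)

text \<open>\<open>left_ideal\<close> is a purely ring-theoretic notion; closure under scalars
  follows because the scalar matrices belong to the algebra and c A = (c 1) A.\<close>

lemma left_ideal_smult:
  assumes "left_ideal J T" "A \<in> J"
  shows "(\<lambda>y z. c * A y z) \<in> J"
proof -
  have A: "A \<in> carrier (mat_alg X)"
    using assms left_ideal_subset[OF assms(1)] lspan_carrier by blast
  have "(\<lambda>y z. c * A y z) = (\<lambda>y z. c * (\<one>\<^bsub>mat_alg X\<^esub> \<otimes>\<^bsub>mat_alg X\<^esub> A) y z)"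
    using ring.ring_simprules(12)[OF ring_mat A] by simp
  also have "\<dots> = (\<lambda>y z. c * \<one>\<^bsub>mat_alg X\<^esub> y z) \<otimes>\<^bsub>mat_alg X\<^esub> A"
    by (simp add: mat_alg_simps(2) sum_distrib_left mult.assoc)
  also have "\<dots> \<in> J"
    by (rule left_ideal_mult[OF assms(1) lspan_smult[OF one_in_lspan] assms(2)])
  finally show ?thesis .
qed

lemma left_ideal_lspan_subset:
  assumes J: "left_ideal J T" and Q: "\<And>s. s \<in> Q \<Longrightarrow> W s \<in> J"
  shows "lspan Q \<subseteq> J"
proof
  fix A assume "A \<in> lspan Q"
  then obtain c where A: "A = (\<lambda>y z. \<Sum>s\<in>Q. c s * W s y z)" by (rule lspanE)
  show "A \<in> J"
    unfolding A using Q
  proof (induction Q rule: infinite_finite_induct)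
    case (insert s Q)
    then have "(\<lambda>y z. c s * W s y z) \<in> J" "(\<lambda>y z. \<Sum>s\<in>Q. c s * W s y z) \<in> J"
      using left_ideal_smult[OF J] by simp_all
    from left_ideal_add[OF J this] show ?case using insert.hyps by simp
  qed (simp_all add: left_ideal_zero[OF J])
qed

text \<open>Two applications of \<open>square_subset_maximal_left_ideal\<close>: products within
  \<open>N\<close> vanish, so the span of \<open>N\<close> lies in M; products within
  \<open>K\<close> land in the span of \<open>N\<close>, so the span of \<open>K\<close>
  follows.\<close>

lemma nil_in_maximal_left_ideal:
  assumes M: "maximal_left_ideal M T" and s: "s \<in> P - G"
  shows "W s \<in> M"
proof -
  obtain K N where K: "s \<in> K" "K \<subseteq> P" and N: "N \<subseteq> P"
    and "\<forall>q\<in>P. \<forall>t\<in>K. W q \<otimes>\<^bsub>mat_alg X\<^esub> W t \<in> insert (\<lambda>y z. 0) (W ` K)"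
      "\<forall>q\<in>P. \<forall>t\<in>N. W q \<otimes>\<^bsub>mat_alg X\<^esub> W t \<in> insert (\<lambda>y z. 0) (W ` N)"
      "\<forall>q\<in>K. \<forall>t\<in>K. W q \<otimes>\<^bsub>mat_alg X\<^esub> W t \<in> insert (\<lambda>y z. 0) (W ` N)"
      "\<forall>q\<in>N. \<forall>t\<in>N. W q \<otimes>\<^bsub>mat_alg X\<^esub> W t = (\<lambda>y z. 0)"
    using W_nil[OF s] by (elim exE conjE)
  note * = this(4-7)[rule_format]
  have fin: "finite K" "finite N" using K N finite_P finite_subset by blast+
  have M': "left_ideal M T" using M by (simp add: maximal_left_ideal_def)
  have "lspan N \<subseteq> M"
  proof (rule square_subset_maximal_left_ideal[OF ring_T left_ideal_lspan[OF N *(2)] M])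
    fix v w assume "v \<in> lspan N" "w \<in> lspan N"
    then have "v \<otimes>\<^bsub>mat_alg X\<^esub> w \<in> lspan {}"
      by (rule lspan_mult[rotated]) (simp add: *(4) lspan_zero)
    then show "v \<otimes>\<^bsub>T\<^esub> w \<in> M"
      using left_ideal_lspan_subset[OF M', of "{}"] by auto
  qed
  moreover have "v \<otimes>\<^bsub>mat_alg X\<^esub> w \<in> lspan N" if "v \<in> lspan K" "w \<in> lspan K" for v w
    by (rule lspan_mult_W[OF fin(2) *(3) that])
  ultimately have "lspan K \<subseteq> M"
    by (intro square_subset_maximal_left_ideal[OF ring_T left_ideal_lspan[OF K(2) *(1)] M])
      (simp_all add: subsetD)
  then show ?thesis
    using W_in_lspan[OF fin(1) K(1)] by blast
qed

text \<open>In matrix terms: matrices vanishing in one column form a maximal left ideal. An element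
  outside has a nonzero coefficient at some s of the column, and multiplying by the transposed unit
  \<open>i s\<close> moves that entry to the diagonal unit \<open>e\<close>.\<close>

lemma maximal_left_ideal_column:
  assumes e: "e \<in> G" "r e = e"
  shows "maximal_left_ideal (lspan (P - {s \<in> G. r s = e})) T" (is "maximal_left_ideal (lspan ?Q) T")
proof -
  have fin: "finite ?Q" using finite_P by simp
  \<comment> \<open>By \<open>W_mult\<close>, a product that lands in the removed column has its
    right factor in \<open>G\<close> with the same \<open>r\<close>, that is, in the removed column
    too.\<close>
  have Qmult: "W q \<otimes>\<^bsub>mat_alg X\<^esub> W t \<in> insert (\<lambda>y z. 0) (W ` ?Q)" if "q \<in> P" "t \<in> ?Q" for q t
    using W_mult[OF that(1), of t] that(2) by auto
  have J: "left_ideal (lspan ?Q) T"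
    by (rule left_ideal_lspan[OF _ Qmult]) auto
  have We: "W e \<notin> lspan ?Q"
  proof
    assume "W e \<in> lspan ?Q"
    then obtain c where c: "W e = (\<lambda>y z. \<Sum>s\<in>?Q. c s * W s y z)" by (rule lspanE)
    have "(\<Sum>s\<in>insert e ?Q. (if s = e then 1 else - c s) * W s y z) = 0" for y z
    proof -
      have "(\<Sum>s\<in>?Q. (if s = e then 1 else - c s) * W s y z) = (\<Sum>s\<in>?Q. - (c s * W s y z))"
        using e by (intro sum.cong) auto
      also have "\<dots> = - W e y z" using c by (simp add: sum_negf)
      finally show ?thesis using e fin by (subst sum.insert) auto
    qed
    from lspan_eq_zero_iff[of "insert e ?Q" "\<lambda>s. if s = e then 1 else - c s" e] this
    show False using e G_subset by auto
  qed
  have "K = carrier T" if K: "left_ideal K T" "lspan ?Q \<subseteq> K" "K \<noteq> lspan ?Q" for K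
  proof -
    obtain A where A: "A \<in> K" "A \<notin> lspan ?Q" using K by blast
    then have "A \<in> lspan P" using left_ideal_subset[OF K(1)] by blast
    then obtain c where c: "A = (\<lambda>y z. \<Sum>s\<in>P. c s * W s y z)" by (rule lspanE)
    have "\<exists>s\<in>G. r s = e \<and> c s \<noteq> 0"
    proof (rule ccontr)
      assume "\<not> ?thesis"
      then have "A = (\<lambda>y z. \<Sum>s\<in>?Q. c s * W s y z)"
        unfolding c using finite_P by (intro ext sum.mono_neutral_right) auto
      then show False using A lspanI by simp
    qed
    then obtain s where s: "s \<in> G" "r s = e" "c s \<noteq> 0" by blast
    have is': "i s \<in> P" "W (i s) \<otimes>\<^bsub>mat_alg X\<^esub> W s = W e" using W_inverse[OF s(1)] s by auto
    \<comment> \<open>\<open>B\<close> cancels all terms of \<open>W (i s)\<close> times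
      \<open>A\<close> except the one at \<open>s\<close>. Terms from the same column vanish by
      \<open>W_annihil\<close>, the others stay in the span of \<open>?Q\<close>, so subtracting
      them does not leave \<open>K\<close>.\<close>
    define B where "B = (\<lambda>y z. \<Sum>q\<in>P - {s}. - c q * (W (i s) \<otimes>\<^bsub>mat_alg X\<^esub> W q) y z)"
    have "B \<in> lspan ?Q"
      unfolding B_def
    proof (rule lspan_sum)
      fix q assume q: "q \<in> P - {s}"
      show "W (i s) \<otimes>\<^bsub>mat_alg X\<^esub> W q \<in> lspan ?Q"
      proof (cases "q \<in> ?Q")
        case True
        then show ?thesis using insert_W_in_lspan[OF fin Qmult[OF is'(1) True]] by simp
      next
        case False
        then have "W (i s) \<otimes>\<^bsub>mat_alg X\<^esub> W q = (\<lambda>y z. 0)"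
          using q s by (intro W_annihil) auto
        then show ?thesis by (simp add: lspan_zero)
      qed
    qed
    moreover have "W (i s) \<otimes>\<^bsub>mat_alg X\<^esub> A \<in> K"
      by (rule left_ideal_mult[OF K(1) W_in_lspan[OF finite_P is'(1)] A(1)])
    ultimately have "(\<lambda>y z. (W (i s) \<otimes>\<^bsub>mat_alg X\<^esub> A) y z + B y z) \<in> K"
      using K(2) left_ideal_add[OF K(1)] by blast
    also have "(\<lambda>y z. (W (i s) \<otimes>\<^bsub>mat_alg X\<^esub> A) y z + B y z) = (\<lambda>y z. c s * W e y z)"
    proof -
      have "s \<in> P" using s G_subset by blast
      then show ?thesis
        unfolding c mat_mult_sum_right B_def unfolding sum.remove[OF finite_P \<open>s \<in> P\<close>]
        by (simp add: is'(2) sum_negf)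
    qed
    finally have "(\<lambda>y z. inverse (c s) * (c s * W e y z)) \<in> K"
      by (rule left_ideal_smult[OF K(1)])
    then have "W e \<in> K" using s by (simp add: mult.assoc[symmetric])
    \<comment> \<open>The identity is the sum of the diagonal units; those other than
      \<open>e\<close> lie in other columns and hence were in \<open>K\<close> from the
      start.\<close>
    have one: "\<one>\<^bsub>mat_alg X\<^esub> \<in> K"
    proof -
      have "W d \<in> K" if "d \<in> G" "r d = d" for d
      proof (cases "d = e")
        case False
        then have "d \<in> ?Q" using that G_subset by auto
        then show ?thesis using K(2) W_in_lspan[OF fin] by blast
      qed (simp add: \<open>W e \<in> K\<close>)
      then have "lspan {e \<in> G. r e = e} \<subseteq> K"
        by (intro left_ideal_lspan_subset[OF K(1)]) auto
      then show ?thesis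
        unfolding W_one using lspan_G_sum[of "{e \<in> G. r e = e}"] by blast
    qed
    have "A \<in> K" if "A \<in> lspan P" for A
      using left_ideal_mult[OF K(1) that one] monoid.r_one[OF ring.is_monoid[OF ring_T], of A] that
      by simp
    then show ?thesis using left_ideal_subset[OF K(1)] by (simp add: subset_antisym subsetI)
  qed
  moreover have "lspan ?Q \<noteq> carrier T"
    using We W_in_lspan[OF finite_P, of e] e G_subset by (metis T_simps(1) subsetD)
  ultimately show ?thesis
    using J unfolding maximal_left_ideal_def by blast
qed

text \<open>For one inclusion, a radical element lies in the ideal of every column, which kills its
  coefficients at all indices in \<open>G\<close>; for the other, every maximal left ideal contains
  the nilpotent basis elements and hence their span.\<close>

lemma jacobson_radical_eq: "jacobson_radical T = lspan (P - G)"
proof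
  show "lspan (P - G) \<subseteq> jacobson_radical T"
  proof -
    have "lspan (P - G) \<subseteq> M" if M: "maximal_left_ideal M T" for M
      using nil_in_maximal_left_ideal[OF M] left_ideal_lspan_subset[of M "P - G"] M
      unfolding maximal_left_ideal_def by blast
    then show ?thesis
      using lspan_subset[of "P - G"] by (auto simp: jacobson_radical_def)
  qed
  show "jacobson_radical T \<subseteq> lspan (P - G)"
  proof
    fix A assume A: "A \<in> jacobson_radical T"
    then have "A \<in> lspan P" by (simp add: jacobson_radical_def)
    then obtain c where c: "A = (\<lambda>y z. \<Sum>s\<in>P. c s * W s y z)" by (rule lspanE)
    have "c s = 0" if s: "s \<in> G" for s
    proof -
      let ?Q = "P - {t \<in> G. r t = r s}"
      have "A \<in> lspan ?Q"
        using A maximal_left_ideal_column[of "r s"] r_idem[OF s] by (auto simp: jacobson_radical_def)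
      then obtain d where d: "A = (\<lambda>y z. \<Sum>t\<in>?Q. d t * W t y z)" by (rule lspanE)
      also have "\<dots> = (\<lambda>y z. \<Sum>t\<in>P. (if t \<in> ?Q then d t else 0) * W t y z)"
        using finite_P by (intro ext sum.mono_neutral_cong_left) auto
      \<comment> \<open>Two expansions of \<open>A\<close> over all of \<open>P\<close>, subtracted;
        the second one has coefficient 0 at \<open>s\<close>, since \<open>s\<close> belongs to its
        own removed column.\<close>
      finally have "(\<lambda>y z. \<Sum>t\<in>P. (c t - (if t \<in> ?Q then d t else 0)) * W t y z) = (\<lambda>y z. 0)"
        unfolding c by (simp add: fun_eq_iff left_diff_distrib sum_subtractf)
      from W_indep[OF this, of s] show ?thesis using s G_subset by auto
    qed
    then have "A = (\<lambda>y z. \<Sum>s\<in>P - G. c s * W s y z)"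
      unfolding c using finite_P by (intro ext sum.mono_neutral_right) auto
    then show "A \<in> lspan (P - G)" using lspanI by simp
  qed
qed

text \<open>Two-sided because, by \<open>W_mult\<close>, a nonzero product lands in \<open>G\<close>
  only if both of its factors come from \<open>G\<close>.\<close>

lemma ideal_radical: "ideal (lspan (P - G)) T"
proof (rule idealI[OF ring_T])
  show "subgroup (lspan (P - G)) (add_monoid T)"
    using additive_subgroup_lspan[of "P - G"] by (auto simp: additive_subgroup_def)
  have fin: "finite (P - G)" using finite_P by simp
  fix A B assume "A \<in> lspan (P - G)" "B \<in> carrier T"
  then have AB: "A \<in> lspan (P - G)" "B \<in> lspan P" by simp_all
  have W: "W q \<otimes>\<^bsub>mat_alg X\<^esub> W t \<in> insert (\<lambda>y z. 0) (W ` (P - G))"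
    if "q \<in> P" "t \<in> P" "q \<notin> G \<or> t \<notin> G" for q t
    using W_mult[OF that(1,2)] that(3) by blast
  show "B \<otimes>\<^bsub>T\<^esub> A \<in> lspan (P - G)"
    unfolding T_simps by (rule lspan_mult_W[OF fin W AB(2,1)]) auto
  show "A \<otimes>\<^bsub>T\<^esub> B \<in> lspan (P - G)"
    unfolding T_simps by (rule lspan_mult_W[OF fin W AB]) auto
qed

section \<open>The quotient by the radical\<close>

lemma vectorspace_head: "vectorspace (class_ring :: 'f ring) (quotient_algebra T (lspan (P - G)))"
  by (rule vectorspace_quotient_algebra[OF module_T ideal_radical]) (simp add: lspan_smult)

lemma finsum_head:
  assumes "H \<subseteq> G"
  shows "(\<Oplus>\<^bsub>quotient_algebra T (lspan (P - G))\<^esub>s\<in>H.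
      c s \<odot>\<^bsub>quotient_algebra T (lspan (P - G))\<^esub> (lspan (P - G) +>\<^bsub>T\<^esub> W s)) =
    lspan (P - G) +>\<^bsub>T\<^esub> (\<lambda>y z. \<Sum>s\<in>H. c s * W s y z)"
proof -
  interpret I: ideal "lspan (P - G)" T by (rule ideal_radical)
  let ?Q = "quotient_algebra T (lspan (P - G))"
  interpret vectorspace "class_ring :: 'f ring" ?Q by (rule vectorspace_head)
  have sm: "c \<odot>\<^bsub>?Q\<^esub> (lspan (P - G) +>\<^bsub>T\<^esub> A) = lspan (P - G) +>\<^bsub>T\<^esub> (\<lambda>y z. c * A y z)"
    if "A \<in> lspan P" for c A
    using quotient_algebra_smult_coset[OF module_T ideal_radical, of A c] that
    by (simp add: lspan_smult)
  have cos: "lspan (P - G) +>\<^bsub>T\<^esub> A \<in> carrier ?Q" if "A \<in> lspan P" for A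
    using that I.a_subset abelian_group.a_rcosetsI[OF I.is_abelian_group]
    by (simp add: quotient_algebra_simps)
  have "finite H" by (rule finite_subset[OF subset_trans[OF assms G_subset] finite_P])
  then show ?thesis
    using assms
  proof (induction H rule: finite_induct)
    case empty
    then show ?case
      using I.a_rcos_zero[OF ideal_radical lspan_zero] by (simp add: quotient_algebra_simps)
  next
    case (insert s H)
    have W: "W t \<in> lspan P" if "t \<in> insert s H" for t
      by (rule W_in_lspan[OF finite_P subsetD[OF G_subset subsetD[OF insert.prems that]]])
    then have H: "W s \<in> lspan P" "(\<lambda>y z. \<Sum>s\<in>H. c s * W s y z) \<in> lspan P"
      by (simp_all add: lspan_sum)
    have "(\<Oplus>\<^bsub>?Q\<^esub>s\<in>insert s H. c s \<odot>\<^bsub>?Q\<^esub> (lspan (P - G) +>\<^bsub>T\<^esub> W s)) =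
      c s \<odot>\<^bsub>?Q\<^esub> (lspan (P - G) +>\<^bsub>T\<^esub> W s) \<oplus>\<^bsub>?Q\<^esub>
      (\<Oplus>\<^bsub>?Q\<^esub>s\<in>H. c s \<odot>\<^bsub>?Q\<^esub> (lspan (P - G) +>\<^bsub>T\<^esub> W s))"
      by (rule finsum_insert) (simp_all add: insert.hyps Pi_def sm W cos lspan_smult)
    also have "\<dots> = (lspan (P - G) +>\<^bsub>T\<^esub> (\<lambda>y z. c s * W s y z)) <+>\<^bsub>T\<^esub>
        (lspan (P - G) +>\<^bsub>T\<^esub> (\<lambda>y z. \<Sum>s\<in>H. c s * W s y z))"
      using insert.IH insert.prems by (simp add: sm[OF H(1)] quotient_algebra_simps(3))
    also have "\<dots> = lspan (P - G) +>\<^bsub>T\<^esub> ((\<lambda>y z. c s * W s y z) \<oplus>\<^bsub>T\<^esub> (\<lambda>y z. \<Sum>s\<in>H. c s * W s y z))"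
      by (rule I.a_rcos_sum) (simp_all add: H lspan_smult)
    finally show ?case using insert.hyps by simp
  qed
qed

text \<open>The part of an expansion over \<open>P - G\<close> is absorbed by the radical, so the
  cosets indexed by \<open>G\<close> generate. A relation among them equates a combination over
  \<open>G\<close> with one over \<open>P - G\<close>, which independence over \<open>P\<close>
  forbids unless it is trivial.\<close>

theorem basis_head:
  shows "inj_on (\<lambda>s. jacobson_radical T +>\<^bsub>T\<^esub> W s) G" (is ?inj)
    and "vectorspace (class_ring :: 'f ring) (quotient_algebra T (jacobson_radical T))"
    and "vectorspace.basis (class_ring :: 'f ring) (quotient_algebra T (jacobson_radical T))
      ((\<lambda>s. jacobson_radical T +>\<^bsub>T\<^esub> W s) ` G)" (is ?basis)
proof -
  let ?I = "lspan (P - G)" and ?Q = "quotient_algebra T (lspan (P - G))"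
  interpret I: ideal ?I T by (rule ideal_radical)
  have fin: "finite G" by (rule finite_subset[OF G_subset finite_P])
  have split: "(\<lambda>y z. (\<Sum>s\<in>P - G. c s * W s y z) + (\<Sum>s\<in>G. c s * W s y z)) =
    (\<lambda>y z. \<Sum>s\<in>P. c s * W s y z)" for c
    by (intro ext sum.subset_diff[OF G_subset finite_P, symmetric])
  have gen: "\<exists>c. v = (\<Oplus>\<^bsub>?Q\<^esub>s\<in>G. c s \<odot>\<^bsub>?Q\<^esub> (?I +>\<^bsub>T\<^esub> W s))" if "v \<in> carrier ?Q" for v
  proof -
    obtain A where A: "A \<in> lspan P" "v = ?I +>\<^bsub>T\<^esub> A"
      using \<open>v \<in> carrier ?Q\<close> by (auto simp: quotient_algebra_simps A_RCOSETS_def')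
    obtain c where c: "A = (\<lambda>y z. \<Sum>s\<in>P. c s * W s y z)" using A(1) by (rule lspanE)
    have G: "(\<lambda>y z. \<Sum>s\<in>G. c s * W s y z) \<in> lspan P" by (rule subsetD[OF lspan_subset[OF G_subset] lspanI])
    have "A = (\<lambda>y z. \<Sum>s\<in>P - G. c s * W s y z) \<oplus>\<^bsub>T\<^esub> (\<lambda>y z. \<Sum>s\<in>G. c s * W s y z)"
      unfolding c by (simp add: split)
    then have "A \<in> ?I +>\<^bsub>T\<^esub> (\<lambda>y z. \<Sum>s\<in>G. c s * W s y z)"
      using lspanI[of c "P - G"] by (auto simp: a_r_coset_def')
    then have "v = ?I +>\<^bsub>T\<^esub> (\<lambda>y z. \<Sum>s\<in>G. c s * W s y z)"
      using A(2) G I.a_repr_independence' by simp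
    then show ?thesis unfolding finsum_head[OF order_refl] by (intro exI[of _ c])
  qed
  have ind: "c s = 0" if "(\<Oplus>\<^bsub>?Q\<^esub>s\<in>G. c s \<odot>\<^bsub>?Q\<^esub> (?I +>\<^bsub>T\<^esub> W s)) = \<zero>\<^bsub>?Q\<^esub>" "s \<in> G" for c s
  proof -
    have "(\<lambda>y z. \<Sum>s\<in>G. c s * W s y z) \<in> lspan P" by (rule subsetD[OF lspan_subset[OF G_subset] lspanI])
    moreover have "?I +>\<^bsub>T\<^esub> (\<lambda>y z. \<Sum>s\<in>G. c s * W s y z) = ?I"
      using that(1) finsum_head[OF order_refl, of c] by (simp add: quotient_algebra_simps(2))
    ultimately have "(\<lambda>y z. \<Sum>s\<in>G. c s * W s y z) \<in> ?I"
      using I.rcos_const_imp_mem by simp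
    then obtain d where d: "(\<lambda>y z. \<Sum>s\<in>G. c s * W s y z) = (\<lambda>y z. \<Sum>s\<in>P - G. d s * W s y z)"
      by (rule lspanE)
    \<comment> \<open>The coefficients of that equation after moving everything to one side.\<close>
    let ?f = "\<lambda>s. if s \<in> G then c s else - d s"
    have "(\<lambda>y z. \<Sum>s\<in>P. ?f s * W s y z) = (\<lambda>y z. 0)"
    proof -
      have "(\<lambda>y z. \<Sum>s\<in>P - G. ?f s * W s y z) = (\<lambda>y z. - (\<Sum>s\<in>P - G. d s * W s y z))"
        unfolding sum_negf[symmetric] by (intro ext sum.cong) auto
      then show ?thesis
        unfolding split[symmetric] using d by (simp add: fun_eq_iff)
    qed
    from W_indep[OF this, of s] show ?thesis using that(2) G_subset by auto
  qed
  have cos: "?I +>\<^bsub>T\<^esub> W s \<in> carrier ?Q" if "s \<in> G" for s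
    using I.a_subset abelian_group.a_rcosetsI[OF I.is_abelian_group]
      W_in_lspan[OF finite_P subsetD[OF G_subset that]]
    by (simp add: quotient_algebra_simps)
  show ?inj
    unfolding jacobson_radical_eq
  proof (rule basis_image(1)[OF vectorspace_head fin], goal_cases)
    case (1 s)
    then show ?case by (rule cos)
  next
    case (2 v)
    then show ?case by (rule gen)
  next
    case (3 c s)
    then show ?case by (rule ind[of c s])
  qed
  show ?basis
    unfolding jacobson_radical_eq
  proof (rule basis_image(2)[OF vectorspace_head fin], goal_cases)
    case (1 s)
    then show ?case by (rule cos)
  next
    case (2 v)
    then show ?case by (rule gen)
  next
    case (3 c s)
    then show ?case by (rule ind[of c s])
  qed
  show "vectorspace (class_ring :: 'f ring) (quotient_algebra T (jacobson_radical T))"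
    unfolding jacobson_radical_eq by (rule vectorspace_head)
qed

end

section \<open>A single factor\<close>

text \<open>
  The Terwilliger algebra of one factor, with base point \<open>x\<close>. For booleans \<open>g, h, i\<close> the matrix
  \<open>loc_B (g, h, i)\<close> is the \<open>(g, i)\<close> block of the identity (if \<open>\<not> h\<close>) or of the all-ones
  matrix (if \<open>h\<close>). If \<open>k = |U| - 1\<close> is invertible, the matrices \<open>loc_C\<close> are the matrix
  units of \<open>M\<^sub>2 \<times> F\<close> (or of \<open>M\<^sub>2\<close>, if \<open>|U| = 2\<close>); otherwise \<open>loc_C = loc_B\<close>.
\<close>

type_synonym btriple = "bool \<times> bool \<times> bool"

text \<open>\<open>F\<close> pins down the field: whether \<open>k\<close> vanishes in it decides
  \<open>good\<close> and \<open>triple_mult\<close>, whose types do not mention the field.\<close>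

locale factor =
  fixes U :: "'u set" and x :: 'u and F :: "'f::field itself"
  assumes finite_U: "finite U" and card_U: "card U \<ge> 2" and x_in_U: "x \<in> U"
begin

definition k :: 'f where "k = of_nat (card U - 1)"

definition large :: bool where "large \<longleftrightarrow> card U > 2"

definition loc_B :: "btriple \<Rightarrow> 'u \<Rightarrow> 'u \<Rightarrow> 'f" where
  "loc_B = (\<lambda>(g, h, i) u v. of_bool ((u \<noteq> x) = g \<and> (v \<noteq> x) = i \<and> (u = v \<or> h)))"

text \<open>For invertible \<open>k\<close> the normalisation \<open>inverse k\<close> is tied to
  the column index \<open>i\<close>, so that the row block times the column block is exactly the 1 x
  1 block. For a large set, \<open>(True, False, True)\<close> becomes I - J/k, the idempotent
  complementary to J/k on the points other than \<open>x\<close>.\<close>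

definition coef :: "btriple \<Rightarrow> bool \<Rightarrow> 'f" where
  "coef = (\<lambda>(g, h, i) l.
    if k = 0 then of_bool (l = h)
    else if h then of_bool l * (if i then inverse k else 1)
    else if l then (if g \<and> i \<and> large then - inverse k else 0) else 1)"

definition loc_C :: "btriple \<Rightarrow> 'u \<Rightarrow> 'u \<Rightarrow> 'f" where
  "loc_C = (\<lambda>(g, h, i) u v. \<Sum>l\<in>UNIV. coef (g, h, i) l * loc_B (g, l, i) u v)"

text \<open>Removes zero and repeated blocks: in an off-diagonal block the identity contributes
  nothing, so \<open>h\<close> is forced; in the 1 x 1 block, and in the other diagonal block when
  there are just two points, identity and all-ones block coincide, so \<open>h\<close> is
  excluded.\<close>

definition valid :: "btriple set" where
  "valid = {(g, h, i). (g \<noteq> i \<longrightarrow> h) \<and> (g = i \<and> h \<longrightarrow> g \<and> large)}"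

definition good :: "btriple set" where
  "good = {(g, h, i) \<in> valid. k = 0 \<longrightarrow> \<not> h}"

text \<open>A column index \<open>i\<close> that is true does not determine the diagonal unit when
  the set is large: I - J/k and J/k both sit there. Off-diagonal units belong to the 2 x 2 matrix
  part, hence to J/k, which explains \<open>i \<and> large\<close>.\<close>

definition diag :: "btriple \<Rightarrow> btriple" where
  "diag = (\<lambda>(g, h, i). if g = i then (g, h, i) else (i, i \<and> large, i))"

definition transp :: "btriple \<Rightarrow> btriple" where
  "transp = (\<lambda>(g, h, i). (i, h, g))"

definition loc_mult :: "('u \<Rightarrow> 'u \<Rightarrow> 'f) \<Rightarrow> ('u \<Rightarrow> 'u \<Rightarrow> 'f) \<Rightarrow> 'u \<Rightarrow> 'u \<Rightarrow> 'f" where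
  "loc_mult A B u v = (\<Sum>w\<in>U. A u w * B w v)"

lemma k_small: "\<not> large \<Longrightarrow> k = 1"
proof -
  assume "\<not> large"
  then have "card U - 1 = 1" using card_U by (simp add: large_def)
  then show ?thesis by (simp add: k_def)
qed

lemma k_zero_large: "k = 0 \<Longrightarrow> large"
  using k_small by fastforce

lemma small_unique:
  assumes "\<not> large" "u \<in> U" "v \<in> U" "u \<noteq> x" "v \<noteq> x"
  shows "u = v"
proof (rule ccontr)
  assume "u \<noteq> v"
  then have "card {x, u, v} = 3" using assms by auto
  moreover have "card {x, u, v} \<le> card U"
    using assms x_in_U finite_U by (intro card_mono) auto
  ultimately show False using assms by (simp add: large_def)
qed

lemma sum_other: "(\<Sum>w\<in>U. of_bool (w \<noteq> x)) = k"
proof -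
  have "(\<Sum>w\<in>U. of_bool (w \<noteq> x)) = (of_nat (card (U \<inter> {w. w \<noteq> x})) :: 'f)"
    using finite_U by simp
  also have "U \<inter> {w. w \<noteq> x} = U - {x}" by auto
  also have "card \<dots> = card U - 1" using x_in_U finite_U by simp
  finally show ?thesis by (simp add: k_def)
qed

section \<open>Products of identity blocks and all-ones blocks\<close>

lemma loc_B_mult_mismatch:
  assumes "i \<noteq> i'"
  shows "loc_mult (loc_B (g, h, i)) (loc_B (i', h', l)) u v = 0"
  unfolding loc_mult_def loc_B_def using assms by (intro sum.neutral) auto

lemma loc_B_mult_left_id:
  assumes "u \<in> U"
  shows "loc_mult (loc_B (g, False, g)) (loc_B (g, h, l)) u v = loc_B (g, h, l) u v"
proof -
  have "loc_mult (loc_B (g, False, g)) (loc_B (g, h, l)) u v =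
      (\<Sum>w\<in>U. if w = u then of_bool ((u \<noteq> x) = g) * loc_B (g, h, l) w v else 0)"
    unfolding loc_mult_def by (intro sum.cong) (auto simp: loc_B_def)
  then show ?thesis using assms finite_U by (auto simp: loc_B_def)
qed

lemma loc_B_mult_right_id:
  assumes "v \<in> U"
  shows "loc_mult (loc_B (g, h, l)) (loc_B (l, False, l)) u v = loc_B (g, h, l) u v"
proof -
  have "loc_mult (loc_B (g, h, l)) (loc_B (l, False, l)) u v =
      (\<Sum>w\<in>U. if w = v then of_bool ((v \<noteq> x) = l) * loc_B (g, h, l) u w else 0)"
    unfolding loc_mult_def by (intro sum.cong) (auto simp: loc_B_def)
  then show ?thesis using assms finite_U by (auto simp: loc_B_def)
qed

text \<open>The scalar counts the available middle points. Its vanishing for \<open>k = 0\<close> is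
  the source of nilpotence.\<close>

lemma loc_B_mult_ones:
  "loc_mult (loc_B (g, True, i)) (loc_B (i, True, l)) u v = (if i then k else 1) * loc_B (g, True, l) u v"
proof -
  have "loc_mult (loc_B (g, True, i)) (loc_B (i, True, l)) u v =
      (\<Sum>w\<in>U. of_bool ((w \<noteq> x) = i)) * loc_B (g, True, l) u v"
    unfolding loc_mult_def sum_distrib_right by (intro sum.cong) (auto simp: loc_B_def)
  also have "(\<Sum>w\<in>U. of_bool ((w \<noteq> x) = i)) = (if i then k else 1)"
  proof (cases i)
    case False
    have "(\<Sum>w\<in>U. of_bool (w = x)) = (\<Sum>w\<in>U. if w = x then 1 else (0::'f))"
      by (intro sum.cong) auto
    with False show ?thesis using x_in_U finite_U by simp
  qed (simp add: sum_other)
  finally show ?thesis .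
qed

lemma loc_B_zero_block: "loc_B (False, True, False) = loc_B (False, False, False)"
  by (auto simp: loc_B_def fun_eq_iff)

lemma loc_B_small_block:
  assumes "\<not> large" "u \<in> U" "v \<in> U"
  shows "loc_B (True, h, True) u v = loc_B (True, False, True) u v"
  using small_unique[OF assms] by (auto simp: loc_B_def)

lemma loc_mult_add_left: "loc_mult (\<lambda>u v. a * A u v + b * B u v) C u v = a * loc_mult A C u v + b * loc_mult B C u v"
  by (simp add: loc_mult_def sum.distrib sum_distrib_left distrib_right mult.assoc)

lemma loc_mult_add_right: "loc_mult C (\<lambda>u v. a * A u v + b * B u v) u v = a * loc_mult C A u v + b * loc_mult C B u v"
  by (simp add: loc_mult_def sum.distrib sum_distrib_left distrib_left mult_ac)

lemma loc_C_eq: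
  "loc_C (g, h, i) = (\<lambda>u v. coef (g, h, i) False * loc_B (g, False, i) u v + coef (g, h, i) True * loc_B (g, True, i) u v)"
  by (simp add: loc_C_def UNIV_bool fun_eq_iff)

lemma loc_C_mult_expand:
  "loc_mult (loc_C (g, h, i)) (loc_C (i', h', l)) u v =
    coef (g, h, i) False * (coef (i', h', l) False * loc_mult (loc_B (g, False, i)) (loc_B (i', False, l)) u v
      + coef (i', h', l) True * loc_mult (loc_B (g, False, i)) (loc_B (i', True, l)) u v) +
    coef (g, h, i) True * (coef (i', h', l) False * loc_mult (loc_B (g, True, i)) (loc_B (i', False, l)) u v
      + coef (i', h', l) True * loc_mult (loc_B (g, True, i)) (loc_B (i', True, l)) u v)"
  unfolding loc_C_eq loc_mult_add_left loc_mult_add_right ..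

lemma loc_C_mult_mismatch:
  "i \<noteq> i' \<Longrightarrow> loc_mult (loc_C (g, h, i)) (loc_C (i', h', l)) u v = 0"
  unfolding loc_C_mult_expand by (simp add: loc_B_mult_mismatch)

text \<open>The multiplication table, with \<open>None\<close> for a zero product. For
  \<open>k = 0\<close> identity blocks act as identities, and among products of two all-ones blocks
  only column times row survives. For a large set with \<open>k\<close> invertible,
  \<open>(True, False, True)\<close> is the one-dimensional factor and the unit in row
  \<open>g\<close>, column \<open>l\<close> of the 2 x 2 part has \<open>h = (g \<or> l)\<close>;
  with two points it has \<open>h = (g \<noteq> l)\<close>.\<close>

definition triple_mult :: "btriple \<Rightarrow> btriple \<Rightarrow> btriple option" where
  "triple_mult = (\<lambda>(g, h, i) (i', h', l).
    if i \<noteq> i' then None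
    else if k = 0 then
      (if \<not> h then Some (g, h', l) else if \<not> h' then Some (g, h, l)
       else if i then None else if g \<and> l then Some (g, True, l) else None)
    else if large then
      (if g \<and> \<not> h \<and> i then (if i' \<and> \<not> h' \<and> l then Some (True, False, True) else None)
       else if i' \<and> \<not> h' \<and> l then None
       else Some (g, g \<or> l, l))
    else Some (g, g \<noteq> l, l))"

lemma valid_iff [simp]:
  "(g, h, i) \<in> valid \<longleftrightarrow> (g \<noteq> i \<longrightarrow> h) \<and> (g = i \<and> h \<longrightarrow> g \<and> large)"
  by (simp add: valid_def)

text \<open>Bilinearity leaves four block products, hence a finite check of identities in
  \<open>k\<close>. The case of two points is separate because there \<open>k = 1\<close> and the
  all-ones block coincides with the identity block.\<close>

lemma loc_C_mult:
  assumes "q \<in> valid" "t \<in> valid" "u \<in> U" "v \<in> U"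
  shows "loc_mult (loc_C q) (loc_C t) u v =
    (case triple_mult q t of None \<Rightarrow> 0 | Some s \<Rightarrow> loc_C s u v)"
proof -
  obtain g h i i' h' l where qt: "q = (g, h, i)" "t = (i', h', l)" by (metis prod_cases3)
  show ?thesis
  proof (cases "i = i'")
    case False
    then show ?thesis by (simp add: qt loc_C_mult_mismatch triple_mult_def)
  next
    case True
    note B = loc_B_mult_left_id[OF assms(3)] loc_B_mult_right_id[OF assms(4)] loc_B_mult_ones
      loc_B_zero_block
    show ?thesis
    proof (cases "large")
      case False
      note loc_B_small_block[OF False assms(3,4), of True]
      then show ?thesis
        using assms(1,2) False k_small[OF False]
        unfolding qt True[symmetric] loc_C_mult_expand
        by (cases g; cases h; cases i; cases h'; cases l)
          (simp_all add: triple_mult_def loc_C_eq coef_def B)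
    next
      case L: True
      show ?thesis
        using assms(1,2) L
        unfolding qt True[symmetric] loc_C_mult_expand
        by (cases "k = 0"; cases g; cases h; cases i; cases h'; cases l)
          (simp_all add: triple_mult_def loc_C_eq coef_def B field_simps)
    qed
  qed
qed

lemma good_iff [simp]: "(g, h, i) \<in> good \<longleftrightarrow> (g, h, i) \<in> valid \<and> (k = 0 \<longrightarrow> \<not> h)"
  by (simp add: good_def)

lemma factor_cases:
  obtains "large" "k = 0" | "large" "k \<noteq> 0" | "\<not> large" "k \<noteq> 0"
  using k_zero_large by blast

lemma triple_mult_valid:
  assumes "q \<in> valid" "t \<in> valid" "triple_mult q t = Some s"
  shows "s \<in> valid"
  using assms
  by (cases q; cases t; cases rule: factor_cases) (auto simp: triple_mult_def split: if_splits)

text \<open>If \<open>k\<close> is invertible, every valid triple is good; if not, an identity block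
  arises as a product only from two identity blocks.\<close>

lemma triple_mult_good:
  assumes "q \<in> valid" "t \<in> valid" "triple_mult q t = Some s" "s \<in> good"
  shows "q \<in> good" "t \<in> good" "diag s = diag t"
  using assms
  by (cases q; cases t; cases rule: factor_cases; auto simp: triple_mult_def diag_def split: if_splits)+

lemma good_transp:
  assumes "s \<in> good"
  shows "transp s \<in> good" "triple_mult (transp s) s = Some (diag s)" "diag s \<in> good"
    "diag (diag s) = diag s"
  using assms
  by (cases s; cases rule: factor_cases;
      auto simp: triple_mult_def diag_def transp_def split: if_splits)+

text \<open>For matrix units this says that e_ji annihilates e_lj from the left for l \<noteq> i;
  equality of \<open>diag\<close> expresses that both units share component and column.\<close>

lemma good_transp_other:
  assumes "s \<in> good" "t \<in> good" "diag t = diag s" "t \<noteq> s"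
  shows "triple_mult (transp s) t = None"
proof -
  obtain g h i g' h' i' where "s = (g, h, i)" "t = (g', h', i')" by (metis prod_cases3)
  then show ?thesis
    using assms
    by (cases g; cases h; cases i; cases g'; cases h'; cases i'; cases rule: factor_cases)
      (simp_all add: triple_mult_def diag_def transp_def)
qed

text \<open>The filtration behind nilpotence at one coordinate: triples with \<open>h\<close> form
  an ideal, their products reach only the all-ones block outside the base point, and that block
  squares to zero.\<close>

lemma triple_mult_nil:
  assumes "q \<in> valid" "t \<in> valid" "triple_mult q t = Some s" "k = 0"
  shows "fst (snd t) \<Longrightarrow> fst (snd s)" "t = (True, True, True) \<Longrightarrow> s = (True, True, True)"
    "fst (snd q) \<Longrightarrow> fst (snd t) \<Longrightarrow> s = (True, True, True)"
    "\<not> (q = (True, True, True) \<and> t = (True, True, True))"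
  using assms by (cases q; cases t; auto simp: triple_mult_def split: if_splits)+

text \<open>Outside the base point, I = (I - J/k) + J/k for a large set with \<open>k\<close>
  invertible; otherwise the identity block is itself one of the units.\<close>

lemma sum_diag:
  assumes "u \<in> U" "v \<in> U"
  shows "(\<Sum>e\<in>{e \<in> good. diag e = e}. loc_C e u v) = of_bool (u = v)"
proof -
  have e: "{e \<in> good. diag e = e} =
    (if k \<noteq> 0 \<and> large then {(False, False, False), (True, False, True), (True, True, True)}
     else {(False, False, False), (True, False, True)})"
    by (cases rule: factor_cases) (auto simp: diag_def split: if_splits)
  show ?thesis
    unfolding e by (auto simp: loc_C_eq coef_def loc_B_def)
qed

text \<open>A coordinate functional written as a weighting of matrix entries. This certificate of
  independence is chosen because such weightings multiply under tensor products.\<close>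

definition dual :: "btriple \<Rightarrow> ('u \<Rightarrow> 'u \<Rightarrow> 'f) \<Rightarrow> bool" where
  "dual s psi \<longleftrightarrow> (\<forall>t\<in>valid. (\<Sum>u\<in>U. \<Sum>v\<in>U. psi u v * loc_C t u v) = of_bool (s = t))"

lemma sum_entry:
  assumes "y \<in> U" "z \<in> U"
  shows "(\<Sum>u\<in>U. \<Sum>v\<in>U. (if u = y \<and> v = z then c else 0) * A u v) = (c * A y z :: 'f)"
proof -
  have "(\<Sum>v\<in>U. (if u = y \<and> v = z then c else 0) * A u v) = (if u = y then c * A y z else 0)" for u
    using assms finite_U by (cases "u = y") (simp_all add: if_distrib[of "\<lambda>t. t * _"] cong: if_cong)
  then show ?thesis using assms finite_U by simp
qed

text \<open>Two entries suffice: no block contains more than two of the basis matrices.\<close>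

lemma dualI:
  assumes "y \<in> U" "z \<in> U" "y' \<in> U" "z' \<in> U"
    and "\<And>t. t \<in> valid \<Longrightarrow> c * loc_C t y z + c' * loc_C t y' z' = of_bool (s = t)"
  shows "\<exists>psi. dual s psi"
  by (rule exI[of _ "\<lambda>u v. (if u = y \<and> v = z then c else 0) + (if u = y' \<and> v = z' then c' else 0)"])
    (simp add: dual_def distrib_right sum.distrib sum_entry assms)

lemma ex_dual:
  assumes "s \<in> valid"
  shows "\<exists>psi. dual s psi"
proof -
  obtain y where y: "y \<in> U" "y \<noteq> x"
  proof -
    have "U - {x} \<noteq> {}"
    proof
      assume "U - {x} = {}"
      then have "U = {x}" using x_in_U by auto
      then show False using card_U by simp
    qed
    then show ?thesis using that by blast
  qed
  obtain z where z: "z \<in> U" "z \<noteq> x" "large \<Longrightarrow> z \<noteq> y"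
  proof (cases large)
    case True
    have "U - {x, y} \<noteq> {}"
    proof
      assume "U - {x, y} = {}"
      then have "U \<subseteq> {x, y}" by auto
      then have "card U \<le> card {x, y}" by (rule card_mono[rotated]) simp
      then show False using True y by (simp add: large_def)
    qed
    then show ?thesis using that by blast
  qed (use y that in blast)
  obtain g h i where s: "s = (g, h, i)" by (metis prod_cases3)
  consider "\<not> g" "\<not> i" | "g" "\<not> i" | "\<not> g" "i" | "g" "i" by blast
  then show ?thesis
  proof cases
    case 1
    with assms s have "s = (False, False, False)" by auto
    then show ?thesis
      using x_in_U by (intro dualI[of x x x x 1 0]) (auto simp: loc_C_eq coef_def loc_B_def)
  next
    case 2
    with assms s have "s = (True, True, False)" by auto
    then show ?thesis
      using x_in_U y by (intro dualI[of y x y x 1 0]) (auto simp: loc_C_eq coef_def loc_B_def)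
  next
    case 3
    with assms s have "s = (False, True, True)" by auto
    \<comment> \<open>For invertible \<open>k\<close> the entry at (x, y) of the row unit is
      \<open>inverse k\<close>, which the weight undoes.\<close>
    then show ?thesis
      using x_in_U y by (intro dualI[of x y x y "if k = 0 then 1 else k" 0])
        (auto simp: loc_C_eq coef_def loc_B_def)
  next
    case 4
    show ?thesis
    proof (cases large)
      case False
      with assms s 4 have "s = (True, False, True)" by auto
      then show ?thesis
        using y False by (intro dualI[of y y y y 1 0]) (auto simp: loc_C_eq coef_def loc_B_def)
    next
      case True
      show ?thesis
      proof (cases h)
        case True
        with s 4 have "s = (True, True, True)" by auto
        \<comment> \<open>For invertible \<open>k\<close> the weights 1 and k - 1 imitate a row sum:
          I - J/k has row sum 0 and J/k has row sum 1. For \<open>k = 0\<close> the off-diagonal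
          entry already separates J from I.\<close>
        then show ?thesis
          using y z \<open>large\<close> by (intro dualI[of y y y z "if k = 0 then 0 else 1" "if k = 0 then 1 else k - 1"])
            (auto simp: loc_C_eq coef_def loc_B_def field_simps)
      next
        case False
        with s 4 have "s = (True, False, True)" by auto
        \<comment> \<open>Diagonal minus off-diagonal entry annihilates every multiple of J and
          gives 1 on I.\<close>
        then show ?thesis
          using y z \<open>large\<close> by (cases "k = 0"; intro dualI[of y y y z 1 "- 1"])
            (auto simp: loc_C_eq coef_def loc_B_def field_simps)
      qed
    qed
  qed
qed

section \<open>Local factors of the generators lie in the span of the basis\<close>

definition spanned :: "('u \<Rightarrow> 'u \<Rightarrow> 'f) \<Rightarrow> bool" where
  "spanned A \<longleftrightarrow> (\<exists>c. \<forall>u\<in>U. \<forall>v\<in>U. A u v = (\<Sum>t\<in>valid. c t * loc_C t u v))"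

lemma spanned_add:
  assumes "spanned A" "spanned B"
  shows "spanned (\<lambda>u v. a * A u v + b * B u v)"
proof -
  obtain c d where "\<forall>u\<in>U. \<forall>v\<in>U. A u v = (\<Sum>t\<in>valid. c t * loc_C t u v)"
    "\<forall>u\<in>U. \<forall>v\<in>U. B u v = (\<Sum>t\<in>valid. d t * loc_C t u v)"
    using assms by (auto simp: spanned_def)
  then show ?thesis
    unfolding spanned_def
    by (intro exI[of _ "\<lambda>t. a * c t + b * d t"])
      (simp add: distrib_right sum.distrib sum_distrib_left mult.assoc)
qed

lemma spanned_cong:
  "spanned A \<Longrightarrow> (\<And>u v. u \<in> U \<Longrightarrow> v \<in> U \<Longrightarrow> A u v = B u v) \<Longrightarrow> spanned B"
  by (auto simp: spanned_def)

lemma spanned_loc_C: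
  assumes "t \<in> valid" shows "spanned (loc_C t)"
  unfolding spanned_def using assms
  by (intro exI[of _ "\<lambda>s. if s = t then 1 else 0"])
    (simp add: if_distrib[of "\<lambda>t. t * _"] cong: if_cong)

lemma spanned_loc_B: "spanned (loc_B (g, h, i))"
proof -
  note C = spanned_add[OF spanned_loc_C spanned_loc_C]
  have "spanned (\<lambda>u v. 0)" using C[of "(False, False, False)" "(False, False, False)" 0 0] by simp
  then have offdiag: "spanned (loc_B (g, False, i))" if "g \<noteq> i"
    by (rule spanned_cong) (use that in \<open>auto simp: loc_B_def\<close>)
  have zero: "spanned (loc_B (False, h, False))"
    by (rule spanned_cong[OF spanned_loc_C[of "(False, False, False)"]])
      (auto simp: loc_C_eq coef_def loc_B_def)
  have col: "spanned (loc_B (True, True, False))"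
    by (rule spanned_cong[OF spanned_loc_C[of "(True, True, False)"]])
      (auto simp: loc_C_eq coef_def)
  have row: "spanned (loc_B (False, True, True))"
    by (rule spanned_cong[OF C[of "(False, True, True)" "(False, True, True)" "if k = 0 then 1 else k" 0]])
      (auto simp: loc_C_eq coef_def)
  have block: "spanned (loc_B (True, h, True))"
  proof (cases large)
    case False
    have "loc_C (True, False, True) = loc_B (True, False, True)"
      by (simp add: loc_C_eq coef_def False k_small[OF False])
    then show ?thesis
      using spanned_cong[OF spanned_loc_C[of "(True, False, True)"]] loc_B_small_block[OF False, of _ _ h]
      by simp
  next
    case True
    \<comment> \<open>For invertible \<open>k\<close>, J = k (J/k) and I = (I - J/k) + J/k; for
      \<open>k = 0\<close> the blocks are basis elements themselves.\<close>
    show ?thesis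
      by (rule spanned_cong[OF C[of "(True, False, True)" "(True, True, True)"
            "if h then 0 else 1" "if h then (if k = 0 then 1 else k) else if k = 0 then 0 else 1"]])
        (use True in \<open>auto simp: loc_C_eq coef_def field_simps\<close>)
  qed
  show ?thesis
    using offdiag zero col row block by (cases g; cases h; cases i) auto
qed

text \<open>Off the diagonal, J - I consists of the column block, the row block and J - I outside
  the base point; the 1 x 1 block contributes nothing.\<close>

lemma spanned_adjacency: "spanned (\<lambda>u v. of_bool ((u \<noteq> v) = j))"
proof (cases j)
  case False
  show ?thesis
    by (rule spanned_cong[OF spanned_add[OF spanned_loc_B[of False False False] spanned_loc_B[of True False True],
            of 1 1]]) (use False in \<open>auto simp: loc_B_def\<close>)
next
  case True
  show ?thesis
    by (rule spanned_cong[OF spanned_add[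
            OF spanned_add[OF spanned_loc_B[of True True False] spanned_loc_B[of False True True], of 1 1]
              spanned_add[OF spanned_loc_B[of True True True] spanned_loc_B[of True False True], of 1 "- 1"],
            of 1 1]])
      (use True in \<open>auto simp: loc_B_def\<close>)
qed

end

section \<open>Tensor products of the factors\<close>

text \<open>Turns three 0/1 vectors into one vector of triples, so that conditions and matrices
  split over coordinates; \<open>restrict\<close> makes it an element of a \<open>PiE\<close>
  set.\<close>

definition enc :: "nat \<Rightarrow> (nat \<Rightarrow> nat) \<Rightarrow> (nat \<Rightarrow> nat) \<Rightarrow> (nat \<Rightarrow> nat) \<Rightarrow> nat \<Rightarrow> btriple" where
  "enc n g h i = (\<lambda>a\<in>{1..n}. (g a = 1, h a = 1, i a = 1))"

locale scheme =
  fixes n :: nat and U :: "nat \<Rightarrow> 'u set" and x :: "nat \<Rightarrow> 'u" and F :: "'f::field itself"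
  assumes U: "\<And>a. a \<in> {1..n} \<Longrightarrow> finite (U a) \<and> card (U a) \<ge> 2"
    and x_point: "x \<in> points n U"
begin

declare atLeastAtMost_iff [simp del] One_nat_def [simp del]

abbreviation C :: "nat \<Rightarrow> btriple \<Rightarrow> 'u \<Rightarrow> 'u \<Rightarrow> 'f" where "C a \<equiv> factor.loc_C (U a) (x a)"
abbreviation B :: "nat \<Rightarrow> btriple \<Rightarrow> 'u \<Rightarrow> 'u \<Rightarrow> 'f" where "B a \<equiv> factor.loc_B (x a)"
definition idx :: "(nat \<Rightarrow> btriple) set" where
  "idx = (\<Pi>\<^sub>E a\<in>{1..n}. factor.valid (U a))"

definition good_idx :: "(nat \<Rightarrow> btriple) set" where
  "good_idx = (\<Pi>\<^sub>E a\<in>{1..n}. factor.good TYPE('f) (U a))"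

definition diag_idx :: "(nat \<Rightarrow> btriple) \<Rightarrow> nat \<Rightarrow> btriple" where
  "diag_idx s = (\<lambda>a\<in>{1..n}. factor.diag (U a) (s a))"

definition transp_idx :: "(nat \<Rightarrow> btriple) \<Rightarrow> nat \<Rightarrow> btriple" where
  "transp_idx s = (\<lambda>a\<in>{1..n}. factor.transp (s a))"

text \<open>The Kronecker product; the value 0 away from the points places it in
  \<open>mat_alg\<close>.\<close>

definition tens :: "(nat \<Rightarrow> 'u \<Rightarrow> 'u \<Rightarrow> 'f) \<Rightarrow> (nat \<Rightarrow> 'u) \<Rightarrow> (nat \<Rightarrow> 'u) \<Rightarrow> 'f" where
  "tens M y z = (if y \<in> points n U \<and> z \<in> points n U then \<Prod>a\<in>{1..n}. M a (y a) (z a) else 0)"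

definition W :: "(nat \<Rightarrow> btriple) \<Rightarrow> (nat \<Rightarrow> 'u) \<Rightarrow> (nat \<Rightarrow> 'u) \<Rightarrow> 'f" where
  "W s = tens (\<lambda>a. C a (s a))"

lemma point_in: "y \<in> points n U \<Longrightarrow> a \<in> {1..n} \<Longrightarrow> y a \<in> U a"
  by (auto simp: points_def)

lemma fac: "a \<in> {1..n} \<Longrightarrow> factor (U a) (x a)"
  using U point_in[OF x_point] by (simp add: factor_def)

lemma finite_points: "finite (points n U)"
  unfolding points_def using U by (intro finite_PiE) auto

lemma tens_carrier: "tens M \<in> carrier (mat_alg (points n U))"
  by (auto simp: tens_def)

lemma tens_cong:
  assumes "\<And>a u v. a \<in> {1..n} \<Longrightarrow> u \<in> U a \<Longrightarrow> v \<in> U a \<Longrightarrow> M a u v = N a u v"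
  shows "tens M = tens N"
  using assms by (auto simp: tens_def fun_eq_iff point_in intro!: prod.cong)

lemma tens_zero:
  assumes "a \<in> {1..n}" "\<And>u v. u \<in> U a \<Longrightarrow> v \<in> U a \<Longrightarrow> M a u v = 0"
  shows "tens M = (\<lambda>y z. 0)"
  using assms by (auto simp: tens_def fun_eq_iff point_in intro!: prod_zero bexI[of _ a])

text \<open>The mixed-product rule: a sum over points of a product over coordinates is the product
  of the local sums.\<close>

lemma tens_mult:
  "tens M \<otimes>\<^bsub>mat_alg (points n U)\<^esub> tens N = tens (\<lambda>a. factor.loc_mult (U a) (M a) (N a))"
proof (intro ext)
  fix y z
  show "(tens M \<otimes>\<^bsub>mat_alg (points n U)\<^esub> tens N) y z = tens (\<lambda>a. factor.loc_mult (U a) (M a) (N a)) y z"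
  proof (cases "y \<in> points n U \<and> z \<in> points n U")
    case True
    have "(tens M \<otimes>\<^bsub>mat_alg (points n U)\<^esub> tens N) y z =
        (\<Sum>w\<in>points n U. \<Prod>a\<in>{1..n}. M a (y a) (w a) * N a (w a) (z a))"
      using True by (simp add: mat_alg_simps tens_def prod.distrib)
    also have "\<dots> = (\<Prod>a\<in>{1..n}. \<Sum>u\<in>U a. M a (y a) u * N a u (z a))"
      unfolding points_def using U by (intro prod_sum_PiE[symmetric]) auto
    also have "\<dots> = tens (\<lambda>a. factor.loc_mult (U a) (M a) (N a)) y z"
      using True by (auto simp: tens_def factor.loc_mult_def[OF fac] intro!: prod.cong)
    finally show ?thesis .
  qed (auto simp: mat_alg_simps tens_def)
qed

text \<open>Multilinear expansion, with \<open>s\<close> choosing one summand at each coordinate. It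
  yields the decomposition of the identity, the spanning property and the formula for D
  alike.\<close>

lemma tens_sum:
  assumes "\<And>a. a \<in> {1..n} \<Longrightarrow> finite (S a)"
    and "\<And>a u v. a \<in> {1..n} \<Longrightarrow> u \<in> U a \<Longrightarrow> v \<in> U a \<Longrightarrow> M a u v = (\<Sum>t\<in>S a. c a t * N a t u v)"
  shows "tens M = (\<lambda>y z. \<Sum>s\<in>(\<Pi>\<^sub>E a\<in>{1..n}. S a). (\<Prod>a\<in>{1..n}. c a (s a)) * tens (\<lambda>a. N a (s a)) y z)"
proof (intro ext)
  fix y z
  show "tens M y z = (\<Sum>s\<in>(\<Pi>\<^sub>E a\<in>{1..n}. S a). (\<Prod>a\<in>{1..n}. c a (s a)) * tens (\<lambda>a. N a (s a)) y z)"
  proof (cases "y \<in> points n U \<and> z \<in> points n U")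
    case True
    then have "tens M y z = (\<Prod>a\<in>{1..n}. \<Sum>t\<in>S a. c a t * N a t (y a) (z a))"
      using assms(2) by (auto simp: tens_def point_in intro!: prod.cong)
    also have "\<dots> = (\<Sum>s\<in>(\<Pi>\<^sub>E a\<in>{1..n}. S a). \<Prod>a\<in>{1..n}. c a (s a) * N a (s a) (y a) (z a))"
      using assms(1) by (intro prod_sum_PiE) auto
    also have "\<dots> = (\<Sum>s\<in>(\<Pi>\<^sub>E a\<in>{1..n}. S a). (\<Prod>a\<in>{1..n}. c a (s a)) * tens (\<lambda>a. N a (s a)) y z)"
      using True by (simp add: tens_def prod.distrib)
    finally show ?thesis .
  qed (auto simp: tens_def)
qed

section \<open>Multiplication and independence of the tensor basis\<close>

lemma idxD: "s \<in> idx \<Longrightarrow> a \<in> {1..n} \<Longrightarrow> s a \<in> factor.valid (U a)"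
  by (auto simp: idx_def)

lemma good_subset_valid: "a \<in> {1..n} \<Longrightarrow> factor.good TYPE('f) (U a) \<subseteq> factor.valid (U a)"
  using factor.good_def[OF fac, where ?'f = 'f] by auto

lemma good_idxD: "s \<in> good_idx \<Longrightarrow> a \<in> {1..n} \<Longrightarrow> s a \<in> factor.good TYPE('f) (U a)"
  by (auto simp: good_idx_def)

lemma good_idx_subset: "good_idx \<subseteq> idx"
  unfolding idx_def good_idx_def using good_subset_valid by (intro PiE_mono) auto

lemma W_mult_eq_zero:
  assumes "q \<in> idx" "t \<in> idx" "a \<in> {1..n}" "factor.triple_mult TYPE('f) (U a) (q a) (t a) = None"
  shows "W q \<otimes>\<^bsub>mat_alg (points n U)\<^esub> W t = (\<lambda>y z. 0)"
  unfolding W_def tens_mult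
  by (rule tens_zero[OF assms(3)])
    (simp add: factor.loc_C_mult[OF fac[OF assms(3)]] idxD assms)

lemma W_mult_eq_W:
  assumes "q \<in> idx" "t \<in> idx" "\<And>a. a \<in> {1..n} \<Longrightarrow> factor.triple_mult TYPE('f) (U a) (q a) (t a) = Some (u a)"
  shows "W q \<otimes>\<^bsub>mat_alg (points n U)\<^esub> W t = W u"
  unfolding W_def tens_mult
  by (rule tens_cong) (simp add: factor.loc_C_mult[OF fac] idxD assms)

lemma W_mult_cases:
  assumes "q \<in> idx" "t \<in> idx"
  obtains "W q \<otimes>\<^bsub>mat_alg (points n U)\<^esub> W t = (\<lambda>y z. 0)"
  | u where "u \<in> idx" "W q \<otimes>\<^bsub>mat_alg (points n U)\<^esub> W t = W u"
    "\<And>a. a \<in> {1..n} \<Longrightarrow> factor.triple_mult TYPE('f) (U a) (q a) (t a) = Some (u a)"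
proof (cases "\<exists>a\<in>{1..n}. factor.triple_mult TYPE('f) (U a) (q a) (t a) = None")
  case True
  then show ?thesis using that(1) W_mult_eq_zero[OF assms] by blast
next
  case False
  define u where "u = (\<lambda>a\<in>{1..n}. the (factor.triple_mult TYPE('f) (U a) (q a) (t a)))"
  have u: "factor.triple_mult TYPE('f) (U a) (q a) (t a) = Some (u a)" if "a \<in> {1..n}" for a
    using False that by (auto simp: u_def)
  have "u \<in> idx"
    unfolding idx_def
  proof (rule PiE_I)
    fix a assume a: "a \<in> {1..n}"
    show "u a \<in> factor.valid (U a)"
      by (rule factor.triple_mult_valid[OF fac[OF a] idxD[OF assms(1) a] idxD[OF assms(2) a] u[OF a]])
  qed (simp add: u_def)
  then show ?thesis using that(2) W_mult_eq_W[OF assms u] u by blast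
qed

text \<open>The product of the local coordinate functionals takes \<open>W t\<close> to a product of
  Kronecker deltas, that is, to 1 if t = s and to 0 otherwise. Applied to the relation it returns
  \<open>c s\<close>.\<close>

lemma W_indep:
  assumes "(\<lambda>y z. \<Sum>s\<in>idx. c s * W s y z) = (\<lambda>y z. 0)" "s \<in> idx"
  shows "c s = 0"
proof -
  have fin: "finite idx" unfolding idx_def by (intro finite_PiE) auto
  have "\<forall>a\<in>{1..n}. \<exists>psi. factor.dual (U a) (x a) (s a) (psi :: 'u \<Rightarrow> 'u \<Rightarrow> 'f)"
    using factor.ex_dual[OF fac] idxD[OF assms(2)] by blast
  then obtain psi where "\<forall>a\<in>{1..n}. factor.dual (U a) (x a) (s a) (psi a :: 'u \<Rightarrow> 'u \<Rightarrow> 'f)"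
    by (rule bchoice[THEN exE])
  then have psi: "(\<Sum>u\<in>U a. \<Sum>v\<in>U a. psi a u v * C a t u v) = of_bool (s a = t)"
    if "a \<in> {1..n}" "t \<in> factor.valid (U a)" for a t
    using that factor.dual_def[OF fac] by blast
  let ?X = "points n U"
  have Phi: "(\<Sum>y\<in>?X. \<Sum>z\<in>?X. (\<Prod>a\<in>{1..n}. psi a (y a) (z a)) * W t y z) = of_bool (t = s)"
    if t: "t \<in> idx" for t
  proof -
    have "(\<Sum>y\<in>?X. \<Sum>z\<in>?X. (\<Prod>a\<in>{1..n}. psi a (y a) (z a)) * W t y z) =
        (\<Sum>y\<in>?X. \<Sum>z\<in>?X. \<Prod>a\<in>{1..n}. psi a (y a) (z a) * C a (t a) (y a) (z a))"
      by (intro sum.cong refl) (simp add: W_def tens_def prod.distrib)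
    also have "\<dots> = (\<Sum>y\<in>?X. \<Prod>a\<in>{1..n}. \<Sum>v\<in>U a. psi a (y a) v * C a (t a) (y a) v)"
      unfolding points_def using U by (intro sum.cong prod_sum_PiE[symmetric] refl) auto
    also have "\<dots> = (\<Prod>a\<in>{1..n}. \<Sum>u\<in>U a. \<Sum>v\<in>U a. psi a u v * C a (t a) u v)"
      unfolding points_def using U by (intro prod_sum_PiE[symmetric]) auto
    also have "\<dots> = (\<Prod>a\<in>{1..n}. of_bool (s a = t a))"
      using psi idxD[OF t] by (intro prod.cong) auto
    also have "\<dots> = of_bool (t = s)"
    proof (cases "t = s")
      case False
      then obtain a where "a \<in> {1..n}" "t a \<noteq> s a"
        using t assms(2) unfolding idx_def by (metis PiE_ext)
      then show ?thesis using False by (auto intro!: bexI[of _ a])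
    qed simp
    finally show ?thesis .
  qed
  have "0 = (\<Sum>y\<in>?X. \<Sum>z\<in>?X. (\<Prod>a\<in>{1..n}. psi a (y a) (z a)) * (\<Sum>t\<in>idx. c t * W t y z))"
    using fun_cong[OF fun_cong[OF assms(1)]] by simp
  also have "\<dots> = (\<Sum>y\<in>?X. \<Sum>z\<in>?X. \<Sum>t\<in>idx. c t * ((\<Prod>a\<in>{1..n}. psi a (y a) (z a)) * W t y z))"
    by (simp add: sum_distrib_left mult_ac)
  also have "\<dots> = (\<Sum>y\<in>?X. \<Sum>t\<in>idx. \<Sum>z\<in>?X. c t * ((\<Prod>a\<in>{1..n}. psi a (y a) (z a)) * W t y z))"
    by (intro sum.cong refl sum.swap)
  also have "\<dots> = (\<Sum>t\<in>idx. \<Sum>y\<in>?X. \<Sum>z\<in>?X. c t * ((\<Prod>a\<in>{1..n}. psi a (y a) (z a)) * W t y z))"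
    by (rule sum.swap)
  also have "\<dots> = (\<Sum>t\<in>idx. c t * of_bool (t = s))"
    by (intro sum.cong refl) (simp only: sum_distrib_left[symmetric] Phi)
  also have "\<dots> = (\<Sum>t\<in>idx. if t = s then c t else 0)"
    by (intro sum.cong) auto
  also have "\<dots> = c s" using fin assms(2) by simp
  finally show ?thesis by simp
qed

lemma one_eq_tens: "\<one>\<^bsub>mat_alg (points n U)\<^esub> = tens (\<lambda>a u v. of_bool (u = v))"
proof (intro ext)
  fix y z
  show "\<one>\<^bsub>mat_alg (points n U)\<^esub> y z = tens (\<lambda>a u v. of_bool (u = v)) y z"
  proof (cases "y \<in> points n U \<and> z \<in> points n U")
    case True
    then have "y = z \<longleftrightarrow> (\<forall>a\<in>{1..n}. y a = z a)"
      unfolding points_def by (metis PiE_ext)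
    then show ?thesis using True by (auto simp: mat_alg_simps tens_def)
  qed (auto simp: mat_alg_simps tens_def)
qed

lemma diag_idx_fixed:
  "{e \<in> good_idx. diag_idx e = e} =
    (\<Pi>\<^sub>E a\<in>{1..n}. {e \<in> factor.good TYPE('f) (U a). factor.diag (U a) e = e})"
proof (intro equalityI subsetI)
  fix e assume e: "e \<in> {e \<in> good_idx. diag_idx e = e}"
  then have eq: "diag_idx e = e" by simp
  have "factor.diag (U a) (e a) = e a" if "a \<in> {1..n}" for a
    using that fun_cong[OF eq, of a] by (simp add: diag_idx_def)
  then show "e \<in> (\<Pi>\<^sub>E a\<in>{1..n}. {e \<in> factor.good TYPE('f) (U a). factor.diag (U a) e = e})"
    using e by (auto simp: good_idx_def PiE_iff)
next
  fix e assume e: "e \<in> (\<Pi>\<^sub>E a\<in>{1..n}. {e \<in> factor.good TYPE('f) (U a). factor.diag (U a) e = e})"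
  then have "diag_idx e = e"
    by (auto simp: diag_idx_def PiE_iff extensional_def fun_eq_iff)
  then show "e \<in> {e \<in> good_idx. diag_idx e = e}"
    using e by (auto simp: good_idx_def PiE_iff)
qed

lemma W_one: "\<one>\<^bsub>mat_alg (points n U)\<^esub> = (\<lambda>y z. \<Sum>e\<in>{e \<in> good_idx. diag_idx e = e}. W e y z)"
proof -
  have "tens (\<lambda>a u v. of_bool (u = v)) =
    (\<lambda>y z. \<Sum>s\<in>(\<Pi>\<^sub>E a\<in>{1..n}. {e \<in> factor.good TYPE('f) (U a). factor.diag (U a) e = e}).
      (\<Prod>a\<in>{1..n}. 1) * tens (\<lambda>a. C a (s a)) y z)"
    by (rule tens_sum) (simp_all add: factor.sum_diag[OF fac])
  then show ?thesis by (simp add: one_eq_tens diag_idx_fixed W_def)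
qed

text \<open>One bad coordinate suffices: there \<open>k = 0\<close> and \<open>h\<close> holds.
  \<open>K\<close> and \<open>N\<close> restrict this coordinate alone and leave all others
  free.\<close>

lemma W_nil:
  assumes "s \<in> idx - good_idx"
  shows "\<exists>K N. s \<in> K \<and> K \<subseteq> idx \<and> N \<subseteq> idx \<and>
      (\<forall>q\<in>idx. \<forall>t\<in>K. W q \<otimes>\<^bsub>mat_alg (points n U)\<^esub> W t \<in> insert (\<lambda>y z. 0) (W ` K)) \<and>
      (\<forall>q\<in>idx. \<forall>t\<in>N. W q \<otimes>\<^bsub>mat_alg (points n U)\<^esub> W t \<in> insert (\<lambda>y z. 0) (W ` N)) \<and>
      (\<forall>q\<in>K. \<forall>t\<in>K. W q \<otimes>\<^bsub>mat_alg (points n U)\<^esub> W t \<in> insert (\<lambda>y z. 0) (W ` N)) \<and>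
      (\<forall>q\<in>N. \<forall>t\<in>N. W q \<otimes>\<^bsub>mat_alg (points n U)\<^esub> W t = (\<lambda>y z. 0))"
proof -
  obtain a where a: "a \<in> {1..n}" "s a \<notin> factor.good TYPE('f) (U a)"
    using assms by (auto simp: idx_def good_idx_def PiE_iff)
  have "s a \<in> factor.valid (U a)" using assms a idxD by blast
  then have k: "factor.k (U a) = (0 :: 'f)" and h: "fst (snd (s a))"
    using a factor.good_def[OF fac[OF a(1)], where ?'f = 'f] by auto
  note nil = factor.triple_mult_nil[OF fac[OF a(1)] idxD[OF _ a(1)] idxD[OF _ a(1)] _ k]
  let ?K = "{t \<in> idx. fst (snd (t a))}" and ?N = "{t \<in> idx. t a = (True, True, True)}"
  have *: "W q \<otimes>\<^bsub>mat_alg (points n U)\<^esub> W t \<in> insert (\<lambda>y z. 0) (W ` S)"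
    if "q \<in> idx" "t \<in> idx" "\<And>u. u \<in> idx \<Longrightarrow> factor.triple_mult TYPE('f) (U a) (q a) (t a) = Some (u a) \<Longrightarrow> u \<in> S" for q t S
    using that(1,2) by (rule W_mult_cases) (use that(3) a in auto)
  have 1: "W q \<otimes>\<^bsub>mat_alg (points n U)\<^esub> W t \<in> insert (\<lambda>y z. 0) (W ` ?K)" if "q \<in> idx" "t \<in> ?K" for q t
    using that nil(1)[of q t] by (intro *) auto
  have 2: "W q \<otimes>\<^bsub>mat_alg (points n U)\<^esub> W t \<in> insert (\<lambda>y z. 0) (W ` ?N)" if "q \<in> idx" "t \<in> ?N" for q t
    using that nil(2)[of q t] by (intro *) auto
  have 3: "W q \<otimes>\<^bsub>mat_alg (points n U)\<^esub> W t \<in> insert (\<lambda>y z. 0) (W ` ?N)" if "q \<in> ?K" "t \<in> ?K" for q t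
    using that nil(3)[of q t] by (intro *) auto
  have 4: "W q \<otimes>\<^bsub>mat_alg (points n U)\<^esub> W t = (\<lambda>y z. 0)" if "q \<in> ?N" "t \<in> ?N" for q t
    using that nil(4)[of q t]
    by (intro W_mult_eq_zero[OF _ _ a(1)]; cases "factor.triple_mult TYPE('f) (U a) (q a) (t a)") auto
  show ?thesis
    by (rule exI[of _ ?K], rule exI[of _ ?N]) (use assms h 1 2 3 4 in blast)
qed

text \<open>The matrix-unit laws transfer coordinate by coordinate; for annihilation, one coordinate
  where the indices differ is enough, as a zero factor kills the tensor.\<close>

sublocale mb: multiplicative_basis "points n U" idx good_idx W diag_idx transp_idx
proof
  show "finite (points n U)" by (rule finite_points)
  show "finite idx" unfolding idx_def by (intro finite_PiE) auto
  show "good_idx \<subseteq> idx" by (rule good_idx_subset)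
  show "W s \<in> carrier (mat_alg (points n U))" for s unfolding W_def by (rule tens_carrier)
  show "c s = 0" if "(\<lambda>y z. \<Sum>s\<in>idx. c s * W s y z) = (\<lambda>y z. 0)" "s \<in> idx" for c s
    using that by (rule W_indep)
  show "\<one>\<^bsub>mat_alg (points n U)\<^esub> = (\<lambda>y z. \<Sum>e\<in>{e \<in> good_idx. diag_idx e = e}. W e y z)"
    by (rule W_one)
next
  fix q t assume qt: "q \<in> idx" "t \<in> idx"
  then show "W q \<otimes>\<^bsub>mat_alg (points n U)\<^esub> W t = (\<lambda>y z. 0) \<or>
    (\<exists>u\<in>idx. W q \<otimes>\<^bsub>mat_alg (points n U)\<^esub> W t = W u \<and>
      (u \<in> good_idx \<longrightarrow> q \<in> good_idx \<and> t \<in> good_idx \<and> diag_idx u = diag_idx t))"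
  proof (rule W_mult_cases)
    fix u assume u: "u \<in> idx" "W q \<otimes>\<^bsub>mat_alg (points n U)\<^esub> W t = W u"
      "\<And>a. a \<in> {1..n} \<Longrightarrow> factor.triple_mult TYPE('f) (U a) (q a) (t a) = Some (u a)"
    have "q \<in> good_idx \<and> t \<in> good_idx \<and> diag_idx u = diag_idx t" if "u \<in> good_idx"
    proof -
      note good = factor.triple_mult_good[OF fac idxD[OF qt(1)] idxD[OF qt(2)] u(3) good_idxD[OF that]]
      have "q \<in> good_idx" "t \<in> good_idx"
        using qt good(1,2) by (auto simp: good_idx_def idx_def PiE_iff)
      moreover have "diag_idx u = diag_idx t"
        unfolding diag_idx_def using good(3) by (intro restrict_ext) auto
      ultimately show ?thesis by blast
    qed
    with u show ?thesis by blast
  qed blast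
next
  fix s assume s: "s \<in> good_idx"
  note tr = factor.good_transp[OF fac good_idxD[OF s]]
  have t: "transp_idx s \<in> idx"
    unfolding idx_def transp_idx_def restrict_PiE_iff
    by (intro ballI subsetD[OF good_subset_valid tr(1)])
  moreover have "W (transp_idx s) \<otimes>\<^bsub>mat_alg (points n U)\<^esub> W s = W (diag_idx s)"
    by (rule W_mult_eq_W[OF t]) (use s good_idx_subset tr(2) in \<open>auto simp: transp_idx_def diag_idx_def\<close>)
  ultimately show "transp_idx s \<in> idx \<and> W (transp_idx s) \<otimes>\<^bsub>mat_alg (points n U)\<^esub> W s = W (diag_idx s)"
    by blast
  show "diag_idx s \<in> good_idx \<and> diag_idx (diag_idx s) = diag_idx s"
    using tr(3,4) by (auto simp: good_idx_def diag_idx_def)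
  fix t' assume t': "t' \<in> good_idx" "diag_idx t' = diag_idx s" "t' \<noteq> s"
  then obtain a where a: "a \<in> {1..n}" "t' a \<noteq> s a"
    using s unfolding good_idx_def by (metis PiE_ext)
  have "factor.diag (U a) (t' a) = factor.diag (U a) (s a)"
    using fun_cong[OF t'(2), of a] a by (simp add: diag_idx_def)
  from factor.good_transp_other[OF fac[OF a(1)] good_idxD[OF s a(1)] good_idxD[OF t'(1) a(1)] this a(2)]
  show "W (transp_idx s) \<otimes>\<^bsub>mat_alg (points n U)\<^esub> W t' = (\<lambda>y z. 0)"
    by (intro W_mult_eq_zero[OF t _ a(1)]) (use t' good_idx_subset a in \<open>auto simp: transp_idx_def\<close>)
qed (rule W_nil)

end

section \<open>The Terwilliger algebra\<close>

lemma subalgebra_sum: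
  assumes H: "is_subalgebra H (mat_alg X)" and "finite S" and "\<And>s. s \<in> S \<Longrightarrow> A s \<in> H"
  shows "(\<lambda>y z. \<Sum>s\<in>S. c s * A s y z) \<in> H"
  using assms(2,3)
proof (induction S rule: finite_induct)
  case empty
  have "\<zero>\<^bsub>mat_alg X\<^esub> \<in> H" using H by (intro subringE(2)) (simp add: is_subalgebra_def)
  then show ?case by simp
next
  case (insert s S)
  have "c s \<odot>\<^bsub>mat_alg X\<^esub> A s \<in> H" using H insert.prems by (simp add: is_subalgebra_def)
  then have "(c s \<odot>\<^bsub>mat_alg X\<^esub> A s) \<oplus>\<^bsub>mat_alg X\<^esub> (\<lambda>y z. \<Sum>s\<in>S. c s * A s y z) \<in> H"
    using H insert by (intro subringE(7)) (simp_all add: is_subalgebra_def)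
  then show ?case using insert.hyps by simp
qed

lemma prod_of_bool:
  "finite S \<Longrightarrow> (\<Prod>a\<in>S. of_bool (Q a)) = (of_bool (\<forall>a\<in>S. Q a) :: 'f::field)"
  by (induction S rule: finite_induct) auto

context scheme
begin

section \<open>Generators and the matrices B as tensor products\<close>

lemma tens_of_bool:
  "tens (\<lambda>a u v. of_bool (Q a u v)) y z =
    of_bool (y \<in> points n U \<and> z \<in> points n U \<and> (\<forall>a\<in>{1..n}. Q a (y a) (z a)))"
  by (auto simp: tens_def prod_of_bool)

lemma point_eq_iff:
  "y \<in> points n U \<Longrightarrow> z \<in> points n U \<Longrightarrow> y = z \<longleftrightarrow> (\<forall>a\<in>{1..n}. y a = z a)"
  unfolding points_def by (metis PiE_ext)

lemma scheme_rel_iff: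
  "(y, z) \<in> scheme_rel n U g \<longleftrightarrow>
    y \<in> points n U \<and> z \<in> points n U \<and> (\<forall>a\<in>{1..n}. (y a \<noteq> z a) = (g a = 1))"
  by (auto simp: scheme_rel_def)

lemma scheme_rel_base_iff:
  "(x, y) \<in> scheme_rel n U g \<longleftrightarrow> y \<in> points n U \<and> (\<forall>a\<in>{1..n}. (y a \<noteq> x a) = (g a = 1))"
  unfolding scheme_rel_iff using x_point by metis

lemma adj_mat_eq: "adj_mat n U j = tens (\<lambda>a u v. of_bool ((u \<noteq> v) = (j a = 1)))"
  by (intro ext) (simp add: adj_mat_def tens_of_bool scheme_rel_iff)

lemma tens_B: "tens (\<lambda>a. B a (g a, h a, i a)) y z =
    of_bool (y \<in> points n U \<and> z \<in> points n U \<and>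
      (\<forall>a\<in>{1..n}. (y a \<noteq> x a) = g a \<and> (z a \<noteq> x a) = i a \<and> (y a = z a \<or> h a)))"
proof -
  have "tens (\<lambda>a. B a (g a, h a, i a)) =
    tens (\<lambda>a u v. of_bool ((u \<noteq> x a) = g a \<and> (v \<noteq> x a) = i a \<and> (u = v \<or> h a)))"
    by (rule tens_cong) (simp add: factor.loc_B_def[OF fac])
  then show ?thesis by (simp only: tens_of_bool)
qed

lemma dual_idem_eq: "dual_idem n U x g = tens (\<lambda>a. B a (g a = 1, False, g a = 1))"
proof (intro ext)
  fix y z
  show "dual_idem n U x g y z = tens (\<lambda>a. B a (g a = 1, False, g a = 1)) y z"
  proof -
    have "y = z \<and> (x, y) \<in> scheme_rel n U g \<longleftrightarrow> y \<in> points n U \<and> z \<in> points n U \<and>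
      (\<forall>a\<in>{1..n}. (y a \<noteq> x a) = (g a = 1) \<and> (z a \<noteq> x a) = (g a = 1) \<and> (y a = z a \<or> False))"
      unfolding scheme_rel_base_iff using point_eq_iff[of y z] by blast
    then show ?thesis
      unfolding tens_B dual_idem_def by (simp only: of_bool_def)
  qed
qed

lemma dual_adj_dual:
  "(dual_idem n U x g \<otimes>\<^bsub>mat_alg (points n U)\<^esub> adj_mat n U j \<otimes>\<^bsub>mat_alg (points n U)\<^esub> dual_idem n U x i) y z =
    (of_bool ((x, y) \<in> scheme_rel n U g \<and> (y, z) \<in> scheme_rel n U j \<and> (x, z) \<in> scheme_rel n U i) :: 'f)"
proof -
  have left: "(dual_idem n U x g \<otimes>\<^bsub>mat_alg (points n U)\<^esub> adj_mat n U j) y w =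
      (of_bool ((x, y) \<in> scheme_rel n U g \<and> (y, w) \<in> scheme_rel n U j) :: 'f)" for w
  proof -
    have "(dual_idem n U x g \<otimes>\<^bsub>mat_alg (points n U)\<^esub> adj_mat n U j) y w =
      (\<Sum>v\<in>points n U. if v = y then
        of_bool ((x, y) \<in> scheme_rel n U g \<and> (y, w) \<in> scheme_rel n U j) else (0 :: 'f))"
      unfolding mat_alg_simps by (intro sum.cong refl) (auto simp: dual_idem_def adj_mat_def)
    then show ?thesis using finite_points by (auto simp: scheme_rel_iff)
  qed
  have "(dual_idem n U x g \<otimes>\<^bsub>mat_alg (points n U)\<^esub> adj_mat n U j \<otimes>\<^bsub>mat_alg (points n U)\<^esub> dual_idem n U x i) y z =
    (\<Sum>w\<in>points n U. (dual_idem n U x g \<otimes>\<^bsub>mat_alg (points n U)\<^esub> adj_mat n U j) y w * dual_idem n U x i w z :: 'f)"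
    by (rule fun_cong[OF fun_cong[OF mat_alg_simps(2)]])
  also have "\<dots> = (\<Sum>w\<in>points n U. if w = z then
        of_bool ((x, y) \<in> scheme_rel n U g \<and> (y, z) \<in> scheme_rel n U j \<and> (x, z) \<in> scheme_rel n U i) else 0)"
    unfolding left by (intro sum.cong refl) (auto simp: dual_idem_def)
  also have "\<dots> = of_bool ((x, y) \<in> scheme_rel n U g \<and> (y, z) \<in> scheme_rel n U j \<and> (x, z) \<in> scheme_rel n U i)"
    using finite_points by (auto simp: scheme_rel_iff)
  finally show ?thesis .
qed

lemma dual_adj_dual_carrier:
  "dual_idem n U x g \<otimes>\<^bsub>mat_alg (points n U)\<^esub> adj_mat n U j \<otimes>\<^bsub>mat_alg (points n U)\<^esub> dual_idem n U x i
    \<in> carrier (mat_alg (points n U) :: ('f, _) module)"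
  by (simp add: dual_adj_dual) (auto simp: scheme_rel_iff)

lemma finite_bin_vecs: "finite (bin_vecs n)"
  unfolding bin_vecs_def by (intro finite_PiE) auto

lemma B_mat_sum: "B_mat n U x g h i =
    (\<lambda>y z. \<Sum>j\<in>{j \<in> bin_vecs n. sym_diff (supp n g) (supp n i) \<subseteq> supp n j \<and> supp n j \<subseteq> supp n h}.
      (dual_idem n U x g \<otimes>\<^bsub>mat_alg (points n U)\<^esub> adj_mat n U j \<otimes>\<^bsub>mat_alg (points n U)\<^esub> dual_idem n U x i) y z :: 'f)"
  unfolding B_mat_def Let_def
  by (rule finsum_mat_alg[OF finite_points _ dual_adj_dual_carrier]) (simp add: finite_bin_vecs)

text \<open>At a given entry only one relation \<open>d\<close>, recording where y and z differ, can
  contribute. Its upper bound by \<open>h\<close> becomes \<open>y a = z a \<or> h a = 1\<close>;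
  the lower bound is automatic, since y and z differ wherever exactly one of them agrees with
  x.\<close>

lemma B_mat_eq: "B_mat n U x g h i = tens (\<lambda>a. B a (g a = 1, h a = 1, i a = 1))"
proof (intro ext)
  fix y z
  let ?J = "{j \<in> bin_vecs n. sym_diff (supp n g) (supp n i) \<subseteq> supp n j \<and> supp n j \<subseteq> supp n h}"
  let ?Q = "\<lambda>j. (x, y) \<in> scheme_rel n U g \<and> (y, z) \<in> scheme_rel n U j \<and> (x, z) \<in> scheme_rel n U i"
  define d where "d = (\<lambda>a\<in>{1..n}. of_bool (y a \<noteq> z a) :: nat)"
  have d: "d \<in> bin_vecs n" "supp n d = {a \<in> {1..n}. y a \<noteq> z a}"
    by (auto simp: d_def bin_vecs_def supp_def)
  have eq_d: "j = d" if "j \<in> bin_vecs n" "(y, z) \<in> scheme_rel n U j" for j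
  proof
    fix a
    show "j a = d a"
    proof (cases "a \<in> {1..n}")
      case True
      then have "j a = 0 \<or> j a = 1" "(y a \<noteq> z a) = (j a = 1)"
        using that by (auto simp: bin_vecs_def scheme_rel_iff PiE_iff)
      then show ?thesis using True by (auto simp: d_def)
    next
      case False
      then show ?thesis using that by (auto simp: d_def bin_vecs_def PiE_iff extensional_def)
    qed
  qed
  have "B_mat n U x g h i y z = (\<Sum>j\<in>?J. of_bool (?Q j) :: 'f)"
    by (simp only: B_mat_sum dual_adj_dual)
  also have "\<dots> = (\<Sum>j\<in>?J. if j = d then of_bool (?Q d) else 0)"
    by (intro sum.cong refl) (use eq_d in auto)
  also have "\<dots> = of_bool (d \<in> ?J \<and> ?Q d)"
    using finite_bin_vecs by auto
  also have "\<dots> = tens (\<lambda>a. B a (g a = 1, h a = 1, i a = 1)) y z"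
  proof -
    have "d \<in> ?J \<and> ?Q d \<longleftrightarrow> y \<in> points n U \<and> z \<in> points n U \<and>
      (\<forall>a\<in>{1..n}. (y a \<noteq> x a) = (g a = 1) \<and> (z a \<noteq> x a) = (i a = 1) \<and> (y a = z a \<or> h a = 1))"
    proof (cases "y \<in> points n U \<and> z \<in> points n U")
      case True
      have Q: "?Q d \<longleftrightarrow> (\<forall>a\<in>{1..n}. (y a \<noteq> x a) = (g a = 1) \<and> (z a \<noteq> x a) = (i a = 1))"
        unfolding scheme_rel_base_iff using True by (auto simp: scheme_rel_iff d_def)
      have J: "d \<in> ?J \<longleftrightarrow> (\<forall>a\<in>{1..n}. ((g a = 1) \<noteq> (i a = 1) \<longrightarrow> y a \<noteq> z a) \<and> (y a = z a \<or> h a = 1))"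
        using d unfolding supp_def by blast
      have "d \<in> ?J \<and> ?Q d \<longleftrightarrow>
        (\<forall>a\<in>{1..n}. (y a \<noteq> x a) = (g a = 1) \<and> (z a \<noteq> x a) = (i a = 1) \<and> (y a = z a \<or> h a = 1))"
        unfolding Q J ball_conj_distrib[symmetric] by (intro ball_cong refl) auto
      then show ?thesis using True by (simp only: simp_thms)
    qed (auto simp: scheme_rel_iff)
    then show ?thesis unfolding tens_B by (simp only:)
  qed
  finally show "B_mat n U x g h i y z = (tens (\<lambda>a. B a (g a = 1, h a = 1, i a = 1)) y z :: 'f)" .
qed

text \<open>At each coordinate \<open>l\<close> chooses between the identity part (0) and the
  all-ones part (1) of the local factor.\<close>

lemma W_expand:
  assumes "\<And>a. a \<in> {1..n} \<Longrightarrow> s a = (g a = 1, h a, i a = 1)"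
  shows "W s = (\<lambda>y z. \<Sum>l\<in>bin_vecs n.
    (\<Prod>a\<in>{1..n}. factor.coef (U a) (s a) (l a = 1)) * B_mat n U x g l i y z)"
proof -
  have "tens (\<lambda>a. C a (s a)) = (\<lambda>y z. \<Sum>l\<in>(\<Pi>\<^sub>E a\<in>{1..n}. {0, 1::nat}).
    (\<Prod>a\<in>{1..n}. factor.coef (U a) (s a) (l a = 1)) * tens (\<lambda>a. B a (g a = 1, l a = 1, i a = 1)) y z)"
    by (rule tens_sum) (simp_all add: assms factor.loc_C_eq[OF fac])
  then show ?thesis by (simp add: W_def B_mat_eq bin_vecs_def)
qed

lemma tens_spanned:
  assumes "\<And>a. a \<in> {1..n} \<Longrightarrow> factor.spanned (U a) (x a) (M a)"
  shows "tens M \<in> mb.lspan idx"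
proof -
  have "\<forall>a\<in>{1..n}. \<exists>c. \<forall>u\<in>U a. \<forall>v\<in>U a. M a u v = (\<Sum>t\<in>factor.valid (U a). c t * C a t u v)"
    using assms factor.spanned_def[OF fac] by blast
  then obtain c where c: "\<forall>a\<in>{1..n}. \<forall>u\<in>U a. \<forall>v\<in>U a. M a u v = (\<Sum>t\<in>factor.valid (U a). c a t * C a t u v)"
    by (rule bchoice[THEN exE])
  have "tens M = (\<lambda>y z. \<Sum>s\<in>(\<Pi>\<^sub>E a\<in>{1..n}. factor.valid (U a)). (\<Prod>a\<in>{1..n}. c a (s a)) * tens (\<lambda>a. C a (s a)) y z)"
    by (rule tens_sum) (use c in auto)
  then show ?thesis
    using mb.lspanI[of "\<lambda>s. \<Prod>a\<in>{1..n}. c a (s a)" idx] by (simp add: W_def idx_def)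
qed

text \<open>The generators are tensor products of locally spanned matrices. Conversely, a subalgebra
  containing them contains every B as a sum of products of generators, and thus every
  \<open>W s\<close> through \<open>W_expand\<close>.\<close>

lemma carrier_terwilliger:
  "\<Inter>{H. is_subalgebra H (mat_alg (points n U)) \<and> adj_mat n U ` bin_vecs n \<union> dual_idem n U x ` bin_vecs n \<subseteq> H} =
    mb.lspan idx" (is "\<Inter>?S = _")
proof (intro equalityI Inter_lower Inter_greatest CollectI conjI mb.is_subalgebra_lspan)
  show "adj_mat n U ` bin_vecs n \<union> dual_idem n U x ` bin_vecs n \<subseteq> mb.lspan idx"
    unfolding adj_mat_eq dual_idem_eq
    using factor.spanned_adjacency[OF fac] factor.spanned_loc_B[OF fac]
    by (auto intro!: tens_spanned)
next
  fix H assume "H \<in> ?S"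
  then have H: "is_subalgebra H (mat_alg (points n U))" "subring H (mat_alg (points n U))"
    and gens: "\<And>g. g \<in> bin_vecs n \<Longrightarrow> adj_mat n U g \<in> H" "\<And>g. g \<in> bin_vecs n \<Longrightarrow> dual_idem n U x g \<in> H"
    by (auto simp: is_subalgebra_def)
  have B: "B_mat n U x g h i \<in> H" if "g \<in> bin_vecs n" "i \<in> bin_vecs n" for g h i
  proof -
    let ?J = "{j \<in> bin_vecs n. sym_diff (supp n g) (supp n i) \<subseteq> supp n j \<and> supp n j \<subseteq> supp n h}"
    let ?A = "\<lambda>j. dual_idem n U x g \<otimes>\<^bsub>mat_alg (points n U)\<^esub> adj_mat n U j \<otimes>\<^bsub>mat_alg (points n U)\<^esub> dual_idem n U x i"
    have A: "?A j \<in> H" if "j \<in> ?J" for j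
      using \<open>g \<in> bin_vecs n\<close> \<open>i \<in> bin_vecs n\<close> that gens by (intro subringE(6)[OF H(2)]) auto
    have "(\<lambda>y z. \<Sum>j\<in>?J. 1 * ?A j y z) \<in> H"
      by (rule subalgebra_sum[OF H(1) _ A]) (simp add: finite_bin_vecs)
    then show ?thesis by (simp only: B_mat_sum mult_1_left)
  qed
  show "mb.lspan idx \<subseteq> H"
  proof
    fix A assume "A \<in> mb.lspan idx"
    then obtain c where c: "A = (\<lambda>y z. \<Sum>s\<in>idx. c s * W s y z)" by (rule mb.lspanE)
    have "W s \<in> H" for s
    proof -
      let ?g = "\<lambda>a\<in>{1..n}. if fst (s a) then 1 else 0 :: nat"
      let ?i = "\<lambda>a\<in>{1..n}. if snd (snd (s a)) then 1 else 0 :: nat"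
      have "W s = (\<lambda>y z. \<Sum>l\<in>bin_vecs n.
        (\<Prod>a\<in>{1..n}. factor.coef (U a) (s a) (l a = 1)) * B_mat n U x ?g l ?i y z)"
        by (rule W_expand[where h = "\<lambda>a. fst (snd (s a))"]) (simp add: prod_eq_iff)
      then show ?thesis
        using subalgebra_sum[OF H(1) finite_bin_vecs B] by (simp add: bin_vecs_def)
    qed
    then show "A \<in> H"
      unfolding c using mb.finite_P by (intro subalgebra_sum[OF H(1)])
  qed
qed

lemma terwilliger_eq: "terwilliger n U x = mb.T"
  unfolding terwilliger_def generated_subalgebra_def carrier_terwilliger mb.T_def ..

section \<open>Triples and divisibility in coordinates\<close>

lemma supp_vec_of: "supp n (vec_of n V) = V \<inter> {1..n}"
  by (auto simp: supp_def vec_of_def)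

text \<open>A product in a field vanishes only if a factor does; this makes the divisibility
  condition a coordinatewise one.\<close>

lemma char_dvd_valency_iff:
  "\<not> CHAR('f) dvd valency n U g \<longleftrightarrow> (\<forall>a\<in>supp n g. factor.k (U a) \<noteq> (0 :: 'f))"
proof -
  have "CHAR('f) dvd valency n U g \<longleftrightarrow> (of_nat (valency n U g) :: 'f) = 0"
    by (simp add: of_nat_eq_0_iff_char_dvd)
  also have "\<dots> \<longleftrightarrow> (\<exists>a\<in>supp n g. (of_nat (card (U a) - 1) :: 'f) = 0)"
    unfolding valency_def of_nat_prod by (subst prod_zero_iff) (auto simp: supp_def)
  also have "\<dots> \<longleftrightarrow> (\<exists>a\<in>supp n g. factor.k (U a) = (0 :: 'f))"
    by (intro bex_cong refl) (simp add: factor.k_def[OF fac] supp_def)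
  finally show ?thesis by blast
qed

lemma enc_in_idx_iff:
  assumes "g \<in> bin_vecs n" "h \<in> bin_vecs n" "i \<in> bin_vecs n"
  shows "enc n g h i \<in> idx \<longleftrightarrow> (g, h, i) \<in> triples n U"
proof -
  have "enc n g h i \<in> idx \<longleftrightarrow> (\<forall>a\<in>{1..n}. ((g a = 1) \<noteq> (i a = 1) \<longrightarrow> h a = 1) \<and>
      ((g a = 1) = (i a = 1) \<and> h a = 1 \<longrightarrow> g a = 1 \<and> card (U a) > 2))"
    unfolding idx_def enc_def restrict_PiE_iff
    by (intro ball_cong refl) (simp add: factor.valid_iff[OF fac] factor.large_def[OF fac])
  also have "\<dots> \<longleftrightarrow> (g, h, i) \<in> triples n U"
    using assms unfolding triples_def circ_part_def supp_def by auto
  finally show ?thesis .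
qed

lemma enc_good_iff:
  assumes "g \<in> bin_vecs n" "h \<in> bin_vecs n" "i \<in> bin_vecs n"
  shows "enc n g h i \<in> good_idx \<longleftrightarrow> (g, h, i) \<in> triples n U \<and> \<not> CHAR('f) dvd valency n U h"
proof -
  have "enc n g h i \<in> good_idx \<longleftrightarrow>
    enc n g h i \<in> idx \<and> (\<forall>a\<in>{1..n}. factor.k (U a) = (0 :: 'f) \<longrightarrow> h a \<noteq> 1)"
    unfolding idx_def good_idx_def enc_def restrict_PiE_iff
    by (auto simp: factor.good_iff[OF fac])
  also have "(\<forall>a\<in>{1..n}. factor.k (U a) = (0 :: 'f) \<longrightarrow> h a \<noteq> 1) \<longleftrightarrow> \<not> CHAR('f) dvd valency n U h"
    unfolding char_dvd_valency_iff supp_def by auto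
  finally show ?thesis using enc_in_idx_iff[OF assms] by simp
qed

lemma good_idx_eq:
  "good_idx = {enc n g h i | g h i. (g, h, i) \<in> triples n U \<and> \<not> CHAR('f) dvd valency n U h}"
proof (intro equalityI subsetI)
  fix s assume s: "s \<in> good_idx"
  define v where "v f = (\<lambda>a\<in>{1..n}. of_bool (f (s a)) :: nat)" for f :: "btriple \<Rightarrow> bool"
  have v: "v f \<in> bin_vecs n" for f by (auto simp: v_def bin_vecs_def)
  have eq: "s = enc n (v fst) (v (\<lambda>t. fst (snd t))) (v (\<lambda>t. snd (snd t)))"
  proof
    fix a show "s a = enc n (v fst) (v (\<lambda>t. fst (snd t))) (v (\<lambda>t. snd (snd t))) a"
      using s by (cases "a \<in> {1..n}") (auto simp: enc_def v_def good_idx_def PiE_iff extensional_def prod_eq_iff)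
  qed
  then show "s \<in> {enc n g h i | g h i. (g, h, i) \<in> triples n U \<and> \<not> CHAR('f) dvd valency n U h}"
    using s enc_good_iff[OF v v v] by (metis (mono_tags, lifting) mem_Collect_eq)
next
  fix s assume "s \<in> {enc n g h i | g h i. (g, h, i) \<in> triples n U \<and> \<not> CHAR('f) dvd valency n U h}"
  then obtain g h i where "s = enc n g h i" "(g, h, i) \<in> triples n U" "\<not> CHAR('f) dvd valency n U h" by blast
  moreover from this have "g \<in> bin_vecs n" "h \<in> bin_vecs n" "i \<in> bin_vecs n" by (auto simp: triples_def)
  ultimately show "s \<in> good_idx" using enc_good_iff by blast
qed

text \<open>A form of \<open>coef\<close> whose product over the coordinates can be read off: a
  support condition, a sign and a normalisation.\<close>

lemma coef_eq:
  assumes a: "a \<in> {1..n}" and valid: "(g, h, i) \<in> factor.valid (U a)"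
    and h: "h \<longrightarrow> factor.k (U a) \<noteq> (0 :: 'f)"
  shows "(factor.coef (U a) (g, h, i) l :: 'f) =
    (if (h \<longrightarrow> l) \<and> (l \<longrightarrow> g \<noteq> i \<or> g \<and> i \<and> card (U a) > 2) \<and> (l \<longrightarrow> factor.k (U a) \<noteq> (0 :: 'f))
     then (if l \<and> \<not> h then - 1 else 1) * (if i \<and> l then inverse (factor.k (U a)) else 1) else 0)"
  using valid h
  by (cases g; cases h; cases i; cases l)
    (simp_all add: factor.coef_def[OF fac[OF a]] factor.valid_iff[OF fac[OF a]]
      factor.large_def[OF fac[OF a]])

text \<open>The union of the sets \<open>U_set\<close> over all sizes, which indexes the double sum
  in D as a single sum.\<close>

definition D_range :: "(nat \<Rightarrow> nat) \<Rightarrow> (nat \<Rightarrow> nat) \<Rightarrow> (nat \<Rightarrow> nat) \<Rightarrow> (nat \<Rightarrow> nat) set" where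
  "D_range g h i = {l \<in> bin_vecs n. preceq n h l \<and> preceq n l (vec_prod n U g i) \<and>
    \<not> CHAR('f) dvd valency n U l}"

lemma D_range_iff:
  assumes "l \<in> bin_vecs n"
  shows "l \<in> D_range g h i \<longleftrightarrow> (\<forall>a\<in>{1..n}. (h a = 1 \<longrightarrow> l a = 1) \<and>
    (l a = 1 \<longrightarrow> (g a = 1) \<noteq> (i a = 1) \<or> g a = 1 \<and> i a = 1 \<and> card (U a) > 2) \<and>
    (l a = 1 \<longrightarrow> factor.k (U a) \<noteq> (0 :: 'f)))"
  unfolding D_range_def preceq_def char_dvd_valency_iff vec_prod_def supp_vec_of circ_part_def
  using assms unfolding supp_def by auto

lemma prod_if_zero:
  "finite S \<Longrightarrow> (\<Prod>a\<in>S. if Q a then f a else (0 :: 'f)) = (if \<forall>a\<in>S. Q a then \<Prod>a\<in>S. f a else 0)"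
  by (induction S rule: finite_induct) auto

text \<open>A coordinate in \<open>l\<close> but not in \<open>h\<close> takes -J/k out of I - J/k
  and yields a sign; each coordinate common to \<open>i\<close> and \<open>l\<close> yields an
  inverse of its local k.\<close>

lemma coef_prod:
  assumes t: "(g, h, i) \<in> triples n U" "\<not> CHAR('f) dvd valency n U h" and l: "l \<in> bin_vecs n"
  shows "(\<Prod>a\<in>{1..n}. factor.coef (U a) (enc n g h i a) (l a = 1) :: 'f) =
    (if l \<in> D_range g h i then (- 1) ^ card (supp n l - supp n h) *
      inverse (of_nat (valency n U (vec_inter n i l))) else 0)"
proof -
  have "enc n g h i \<in> idx"
    using t enc_in_idx_iff by (auto simp: triples_def)
  then have valid: "(g a = 1, h a = 1, i a = 1) \<in> factor.valid (U a)" if "a \<in> {1..n}" for a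
    using idxD[of "enc n g h i" a] that by (simp add: enc_def)
  have k: "h a = 1 \<longrightarrow> factor.k (U a) \<noteq> (0 :: 'f)" if "a \<in> {1..n}" for a
    using t(2) that unfolding char_dvd_valency_iff by (auto simp: supp_def)
  have "(\<Prod>a\<in>{1..n}. factor.coef (U a) (enc n g h i a) (l a = 1) :: 'f) =
    (\<Prod>a\<in>{1..n}. if (h a = 1 \<longrightarrow> l a = 1) \<and>
      (l a = 1 \<longrightarrow> (g a = 1) \<noteq> (i a = 1) \<or> g a = 1 \<and> i a = 1 \<and> card (U a) > 2) \<and>
      (l a = 1 \<longrightarrow> factor.k (U a) \<noteq> (0 :: 'f))
     then (if l a = 1 \<and> h a \<noteq> 1 then - 1 else 1) * (if i a = 1 \<and> l a = 1 then inverse (factor.k (U a)) else 1)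
     else 0)"
    using coef_eq[OF _ valid k] by (intro prod.cong refl) (simp add: enc_def)
  also have "\<dots> = (if l \<in> D_range g h i then
      (\<Prod>a\<in>{1..n}. (if l a = 1 \<and> h a \<noteq> 1 then - 1 else 1) *
        (if i a = 1 \<and> l a = 1 then inverse (factor.k (U a)) else 1)) else 0)"
    unfolding D_range_iff[OF l] by (rule prod_if_zero) simp
  also have "(\<Prod>a\<in>{1..n}. (if l a = 1 \<and> h a \<noteq> 1 then - 1 else 1) *
        (if i a = 1 \<and> l a = 1 then inverse (factor.k (U a)) else 1)) =
      (\<Prod>a\<in>{1..n}. if l a = 1 \<and> h a \<noteq> 1 then - 1 else (1 :: 'f)) *
      (\<Prod>a\<in>{1..n}. if i a = 1 \<and> l a = 1 then inverse (factor.k (U a)) else 1)"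
    by (rule prod.distrib)
  also have "(\<Prod>a\<in>{1..n}. if l a = 1 \<and> h a \<noteq> 1 then - 1 else (1 :: 'f)) =
      (\<Prod>a\<in>supp n l - supp n h. - 1)"
    by (rule prod.mono_neutral_cong_right) (auto simp: supp_def)
  also have "\<dots> = (- 1) ^ card (supp n l - supp n h)"
    by simp
  also have "(\<Prod>a\<in>{1..n}. if i a = 1 \<and> l a = 1 then inverse (factor.k (U a)) else (1 :: 'f)) =
      (\<Prod>a\<in>supp n i \<inter> supp n l. inverse (of_nat (card (U a) - 1)))"
    by (rule prod.mono_neutral_cong_right) (auto simp: supp_def factor.k_def[OF fac])
  also have "\<dots> = inverse (of_nat (valency n U (vec_inter n i l)))"
  proof -
    have "supp n (vec_inter n i l) = supp n i \<inter> supp n l"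
      unfolding vec_inter_def supp_vec_of by (auto simp: supp_def)
    then show ?thesis
      unfolding valency_def of_nat_prod by (simp add: prod_inversef[symmetric] comp_def)
  qed
  finally show ?thesis .
qed

text \<open>The double sum is the expansion of one tensor product, grouped by the number of
  coordinates that \<open>l\<close> adds to \<open>h\<close>.\<close>

lemma D_mat_eq:
  assumes t: "(g, h, i) \<in> triples n U" "\<not> CHAR('f) dvd valency n U h"
  shows "D_mat n U x g h i = W (enc n g h i)"
proof -
  let ?f = "vec_prod n U g i" and ?M = "mat_alg (points n U) :: ('f, _) module"
  let ?c = "\<lambda>k l. (- 1) ^ k * inverse (of_nat (valency n U (vec_inter n i l))) :: 'f"
  let ?N = "{0..n_num CHAR('f) n U ?f h}"
  have U_set: "U_set CHAR('f) n U ?f h k = {l \<in> D_range g h i. card (supp n l - supp n h) = k}" for k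
    by (auto simp: U_set_def D_range_def)
  have fin: "finite (D_range g h i)" unfolding D_range_def using finite_bin_vecs by simp
  have Bc: "c \<odot>\<^bsub>?M\<^esub> B_mat n U x g l i \<in> carrier ?M" for c l
    using tens_carrier unfolding B_mat_eq by simp
  have inner: "(\<Oplus>\<^bsub>?M\<^esub>l\<in>U_set CHAR('f) n U ?f h k. ?c k l \<odot>\<^bsub>?M\<^esub> B_mat n U x g l i) =
    (\<lambda>y z. \<Sum>l\<in>U_set CHAR('f) n U ?f h k. (?c k l \<odot>\<^bsub>?M\<^esub> B_mat n U x g l i) y z)" for k
    by (rule finsum_mat_alg[OF finite_points _ Bc]) (simp add: U_set fin)
  have outer: "(\<lambda>y z. \<Sum>l\<in>U_set CHAR('f) n U ?f h k. (?c k l \<odot>\<^bsub>?M\<^esub> B_mat n U x g l i) y z) \<in> carrier ?M" for k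
    using Bc by auto
  \<comment> \<open>The upper limit of the outer sum loses nothing: each added coordinate lies in
    the support of the product and has invertible local k, so it is counted by
    \<open>n_num\<close>.\<close>
  have bound: "(\<lambda>l. card (supp n l - supp n h)) ` D_range g h i \<subseteq> ?N"
  proof (rule image_subsetI)
    fix l assume l: "l \<in> D_range g h i"
    have "supp n l - supp n h \<subseteq> {a \<in> supp n ?f - supp n h. \<not> CHAR('f) dvd card (U a) - 1}"
    proof
      fix a assume a: "a \<in> supp n l - supp n h"
      then have "a \<in> {1..n}" by (simp add: supp_def)
      moreover have "factor.k (U a) \<noteq> (0 :: 'f)" "a \<in> supp n ?f"
        using l a unfolding D_range_def char_dvd_valency_iff preceq_def by auto
      ultimately show "a \<in> {a \<in> supp n ?f - supp n h. \<not> CHAR('f) dvd card (U a) - 1}"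
        using a by (simp add: factor.k_def[OF fac] of_nat_eq_0_iff_char_dvd)
    qed
    then have "card (supp n l - supp n h) \<le> n_num CHAR('f) n U ?f h"
      unfolding n_num_def by (intro card_mono) (auto simp: supp_def)
    then show "card (supp n l - supp n h) \<in> ?N" by (simp add: atLeastAtMost_iff)
  qed
  have "D_mat n U x g h i = (\<lambda>y z. \<Sum>k\<in>?N. \<Sum>l\<in>U_set CHAR('f) n U ?f h k. ?c k l * B_mat n U x g l i y z)"
    unfolding D_mat_def Let_def inner by (subst finsum_mat_alg[OF finite_points _ outer]) simp_all
  also have "\<dots> = (\<lambda>y z. \<Sum>k\<in>?N. \<Sum>l\<in>{l \<in> D_range g h i. card (supp n l - supp n h) = k}.
      ?c (card (supp n l - supp n h)) l * B_mat n U x g l i y z)"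
    unfolding U_set by (intro ext sum.cong refl) simp
  also have "\<dots> = (\<lambda>y z. \<Sum>l\<in>D_range g h i. ?c (card (supp n l - supp n h)) l * B_mat n U x g l i y z)"
    by (intro ext sum.group[OF fin _ bound]) simp
  also have "\<dots> = (\<lambda>y z. \<Sum>l\<in>bin_vecs n.
      (\<Prod>a\<in>{1..n}. factor.coef (U a) (enc n g h i a) (l a = 1)) * B_mat n U x g l i y z)"
    by (intro ext sum.mono_neutral_cong_left finite_bin_vecs)
      (auto simp: coef_prod[OF t] D_range_def)
  also have "\<dots> = W (enc n g h i)"
    by (rule W_expand[symmetric, where h = "\<lambda>a. h a = 1"]) (simp add: enc_def)
  finally show ?thesis .
qed

text \<open>The dimension can be counted on indices because distinct good indices give distinct
  cosets.\<close>

lemma terwilliger_head_basis: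
  shows "vectorspace.basis (class_ring :: 'f ring) (terwilliger_head n U x)
      {jacobson_radical (terwilliger n U x) +>\<^bsub>terwilliger n U x\<^esub> D_mat n U x a b c | a b c.
        (a, b, c) \<in> triples n U \<and> \<not> CHAR('f) dvd valency n U b}" (is ?basis)
    and "vectorspace.dim (class_ring :: 'f ring) (terwilliger_head n U x) = card good_idx" (is ?dim)
proof -
  let ?w = "\<lambda>s. jacobson_radical mb.T +>\<^bsub>mb.T\<^esub> W s"
  have "{jacobson_radical mb.T +>\<^bsub>mb.T\<^esub> D_mat n U x a b c | a b c.
      (a, b, c) \<in> triples n U \<and> \<not> CHAR('f) dvd valency n U b} = ?w ` good_idx"
  proof (intro equalityI subsetI)
    fix v assume "v \<in> {jacobson_radical mb.T +>\<^bsub>mb.T\<^esub> D_mat n U x a b c | a b c.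
      (a, b, c) \<in> triples n U \<and> \<not> CHAR('f) dvd valency n U b}"
    then obtain a b c where abc: "v = jacobson_radical mb.T +>\<^bsub>mb.T\<^esub> D_mat n U x a b c"
      "(a, b, c) \<in> triples n U" "\<not> CHAR('f) dvd valency n U b"
      by blast
    then have "v = ?w (enc n a b c)" by (simp only: D_mat_eq[OF abc(2,3)])
    then show "v \<in> ?w ` good_idx" unfolding good_idx_eq using abc by blast
  next
    fix v assume "v \<in> ?w ` good_idx"
    then obtain a b c where abc: "v = ?w (enc n a b c)"
      "(a, b, c) \<in> triples n U" "\<not> CHAR('f) dvd valency n U b"
      unfolding good_idx_eq by blast
    then have "v = jacobson_radical mb.T +>\<^bsub>mb.T\<^esub> D_mat n U x a b c"
      by (simp only: D_mat_eq[OF abc(2,3)])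
    then show "v \<in> {jacobson_radical mb.T +>\<^bsub>mb.T\<^esub> D_mat n U x a b c | a b c.
      (a, b, c) \<in> triples n U \<and> \<not> CHAR('f) dvd valency n U b}"
      using abc(2,3) by blast
  qed
  then show ?basis
    unfolding terwilliger_head_def terwilliger_eq using mb.basis_head(3) by simp
  have "finite good_idx" by (rule finite_subset[OF good_idx_subset mb.finite_P])
  then show ?dim
    unfolding terwilliger_head_def terwilliger_eq
    using vectorspace.dim_basis[OF mb.basis_head(2) _ mb.basis_head(3)] card_image[OF mb.basis_head(1)]
    by simp
qed

end

theorem theorem7p4:
  fixes n :: nat and U :: "nat \<Rightarrow> 'u set"
  assumes "n \<ge> 1"
    and "\<And>h. h \<in> {1..n} \<Longrightarrow> finite (U h) \<and> card (U h) \<ge> 2"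
  shows "(\<forall>x\<in>points n U.
           vectorspace.basis (class_ring :: 'f::field ring) (terwilliger_head n U x)
             {jacobson_radical (terwilliger n U x) +>\<^bsub>terwilliger n U x\<^esub> D_mat n U x a b c | a b c.
               (a, b, c) \<in> triples n U \<and> \<not> CHAR('f) dvd valency n U b}) \<and>
         (\<forall>x\<in>points n U. \<forall>x'\<in>points n U.
           vectorspace.dim (class_ring :: 'f ring) (terwilliger_head n U x) =
           vectorspace.dim (class_ring :: 'f ring) (terwilliger_head n U x'))"
proof -
  have scheme: "scheme n U x" if "x \<in> points n U" for x
    using assms(2) that by (rule scheme.intro)
  \<comment> \<open>Both dimensions become the cardinality of the same \<open>good_idx\<close>,
    which depends on \<open>n\<close>, \<open>U\<close> and the field but not on the base
    point.\<close>
  show ?thesis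
    by (intro conjI ballI) (simp_all only: scheme.terwilliger_head_basis[OF scheme])
qed

end
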